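(* There exist compactly supported probability measures $\mu$ on $\mathbb{R}$ with infinite support that are purely singular with respect to Lebesgue measure and such that for every $x\in(-2,2)$ and any $a,b\in\mathbb{R}$, $$\lim_{n\to\infty}\frac{K_n\left(x+\frac an,\,x+\frac bn\right)}{K_n(x,x)}=\frac{\sin\left((\sqrt{4-x^2})^{-1}(b-a)\right)}{(\sqrt{4-x^2})^{-1}(b-a)} ,$$ where $K_n$ is the Christoffel–Darboux kernel of $\mu$ and the right-hand side is interpreted as $1$ when $a=b$.
   Context: For a compactly supported probability measure $\mu$ on $\mathbb{R}$ whose support is not a finite set, let $\{p_n\}_{n\ge 0}$ be its orthonormal polynomials: $p_n$ is a polynomial of degree $n$ with positive leading coefficient and $\int p_np_m\,d\mu=\delta_{m,n}$. The Christoffel–Darboux kernel of $\mu$ is $K_n(x,y)=\sum_{j=0}^{n-1}p_j(x)p_j(y)$. *)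

theory Defs
  imports "HOL-Probability.Probability" "HOL-Computational_Algebra.Polynomial"
begin

definition measure_support :: "'a::topological_space measure \<Rightarrow> 'a set" where
  "measure_support M = {x. \<forall>U. open U \<longrightarrow> x \<in> U \<longrightarrow> emeasure M U > 0}"

definition mutually_singular :: "'a measure \<Rightarrow> 'a measure \<Rightarrow> bool" where
  "mutually_singular M N \<longleftrightarrow>
     sets M = sets N \<and> (\<exists>A\<in>sets M. emeasure M (space M - A) = 0 \<and> emeasure N A = 0)"

text \<open>
  If \<open>M\<close> is a compactly supported Borel probability measure with infinite support, there is
  exactly one such sequence \<open>p\<close>.
\<close>

definition orthonormal_polys :: "real measure \<Rightarrow> (nat \<Rightarrow> real poly) \<Rightarrow> bool" where
  "orthonormal_polys M p \<longleftrightarrow>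
     (\<forall>n. degree (p n) = n \<and> lead_coeff (p n) > 0) \<and>
     (\<forall>m n. integrable M (\<lambda>x. poly (p n) x * poly (p m) x) \<and>
            (\<integral>x. poly (p n) x * poly (p m) x \<partial>M) = (if m = n then 1 else 0))"

definition CD_kernel :: "(nat \<Rightarrow> real poly) \<Rightarrow> nat \<Rightarrow> real \<Rightarrow> real \<Rightarrow> real" where
  "CD_kernel p n x y = (\<Sum>j<n. poly (p j) x * poly (p j) y)"

end

theory Submission
  imports Defs "HOL-Complex_Analysis.Complex_Analysis"
begin

text \<open>
  The measure is the image under \<open>z \<mapsto> z + 1/z\<close> of the measure on the unit circle with real, sparse,
  decaying but not square summable Verblunsky coefficients \<open>r k\<close>. Stopping the Szego recursion after
  \<open>k\<close> nonzero coefficients gives the measure with density \<open>h k / |a k z|^2\<close>, and the moments below the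
  degree at which the next coefficient enters are already final.

  Singularity: when the next gap is long, the new factor of the density oscillates so fast that it is
  averaged independently of the rest, so the integral of the square root of the density is multiplied
  by about \<open>1 - (r k)^2/4\<close>; it tends to zero because the squares of the \<open>r k\<close> have infinite sum. Hence
  \<open>|a k| / sqrt (h k)\<close> tends to zero in \<open>L^1\<close> of the limit measure and its inverse tends to zero in
  \<open>L^1\<close> of Lebesgue measure.

  Universality: between two nonzero coefficients the orthonormal polynomials are exactly
  \<open>Re (z^j * A z)\<close>. The gaps are so long that, at scale \<open>1/n\<close>, the amplitude \<open>A\<close> is nearly constant and only
  two consecutive blocks contribute to the kernel, with nearly equal amplitudes as \<open>r k\<close> tends to zero.
  So the kernel behaves as in the free case.
\<close>

section \<open>Integrals over the unit circle\<close>

text \<open>In the usual notation \<open>a k\<close> is the monic orthogonal polynomial of degree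
  \<open>d k\<close> on the circle, \<open>b k\<close> its reversal and \<open>h k\<close> its
  squared norm; multiplying by \<open>z ^ m k\<close> runs through \<open>m k - 1\<close> zero
  coefficients before \<open>r k\<close> enters. Real coefficients make everything symmetric under
  conjugation, so it descends to the interval. Integrals are evaluated in one way: multiplied by a
  high enough power of \<open>z\<close>, a polynomial in \<open>Re z\<close> becomes analytic, and
  the mean value property applies.

  The gaps are chosen one after another, each once the current polynomials are known, and every
  demand on a gap is met as soon as it is long enough. Amplitudes therefore need only crude bounds,
  exponential in the block index, since the degrees grow at least by the factor
  \<open>100 ^ k\<close>. Longer gaps do not reduce the change of the amplitude across one nonzero
  coefficient, which is of relative size \<open>r k\<close>; the decay of \<open>r\<close> serves to
  control exactly that.\<close>

definition circ :: "real \<Rightarrow> complex" where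
  "circ t = cis (2 * pi * t)"

lemma norm_circ [simp]: "norm (circ t) = 1"
  by (simp add: circ_def)

lemma circ_nonzero [simp]: "circ t \<noteq> 0"
  by (simp add: circ_def)

lemma continuous_on_circ [continuous_intros]: "continuous_on S circ"
  unfolding circ_def by (intro continuous_intros)

lemma circle_mean_value:
  assumes "g holomorphic_on cball 0 1"
  shows "((\<lambda>t. g (circ t)) has_integral g 0) {0..1}"
proof -
  have "((\<lambda>u. g u / (u - 0)) has_contour_integral (2 * of_real pi * \<i> * g 0)) (circlepath 0 1)"
    by (rule Cauchy_integral_circlepath_simple) (use assms in auto)
  then have "((\<lambda>t. g (circ t) * (2 * of_real pi * \<i>)) has_integral (2 * of_real pi * \<i> * g 0)) {0..1}"
    unfolding has_contour_integral
  proof (rule has_integral_eq[rotated])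
    fix t :: real
    have "circlepath 0 1 t = circ t"
      by (simp add: circlepath circ_def cis_conv_exp mult_ac)
    then show "g (circlepath 0 1 t) / (circlepath 0 1 t - 0) * vector_derivative (circlepath 0 1) (at t)
        = g (circ t) * (2 * of_real pi * \<i>)"
      unfolding vector_derivative_circlepath using circ_nonzero[of t]
      by (simp add: circ_def cis_conv_exp mult_ac)
  qed
  then have "((\<lambda>t. g (circ t) * (2 * of_real pi * \<i>) * inverse (2 * of_real pi * \<i>))
      has_integral (2 * of_real pi * \<i> * g 0 * inverse (2 * of_real pi * \<i>))) {0..1}"
    by (rule has_integral_mult_left)
  then show ?thesis
    by (simp add: field_simps)
qed

lemma unit_circle_mult_Re:
  assumes "norm (z :: complex) = 1"
  shows "z * of_real (2 * Re z) = z\<^sup>2 + 1"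
proof -
  have "z * cnj z = 1"
    using assms by (simp add: complex_norm_square[symmetric])
  moreover have "of_real (2 * Re z) = z + cnj z"
    by (simp add: complex_add_cnj)
  ultimately show ?thesis
    by (simp add: algebra_simps power2_eq_square)
qed

text \<open>The source of the orthogonality relations below. On the circle \<open>z\<close> times
  \<open>2 * Re z\<close> equals \<open>z\<^sup>2 + 1\<close>, so multiplying a polynomial of degree
  at most \<open>n\<close> in \<open>2 * Re z\<close> by \<open>z ^ n\<close> clears all negative
  powers of \<open>z\<close>. The mean value property then evaluates at 0, where only the top
  coefficient survives.\<close>

lemma circle_integral_poly:
  fixes q :: "real poly"
  assumes g: "g holomorphic_on cball 0 1" and q: "degree q \<le> n"
  shows "((\<lambda>t. poly q (2 * Re (circ t)) * Re (circ t ^ n * g (circ t)))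
           has_integral coeff q n * Re (g 0)) {0..1}"
proof -
  define Q :: "complex \<Rightarrow> complex" where
    "Q z = (\<Sum>j\<le>n. of_real (coeff q j) * (z\<^sup>2 + 1) ^ j * z ^ (n - j))" for z
  have Q: "of_real (poly q (2 * Re z)) * z ^ n = Q z" if "norm z = 1" for z
  proof -
    have "of_real (poly q (2 * Re z)) * z ^ n
      = (\<Sum>j\<le>n. of_real (coeff q j) * (of_real (2 * Re z)) ^ j * z ^ n)"
    proof -
      have "poly q x = (\<Sum>j\<le>n. coeff q j * x ^ j)" for x
        by (subst poly_as_sum_of_monoms'[OF q, symmetric]) (simp only: poly_sum poly_monom)
      then show ?thesis by (simp add: sum_distrib_right)
    qed
    also have "\<dots> = Q z"
      unfolding Q_def
    proof (rule sum.cong)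
      fix j assume "j \<in> {..n}"
      then have "z ^ n = z ^ j * z ^ (n - j)"
        by (simp only: power_add[symmetric] atMost_iff le_add_diff_inverse)
      moreover have "z ^ j * of_real (2 * Re z) ^ j = (z\<^sup>2 + 1) ^ j"
        unfolding unit_circle_mult_Re[OF that, symmetric] power_mult_distrib ..
      ultimately show "of_real (coeff q j) * (of_real (2 * Re z)) ^ j * z ^ n
          = of_real (coeff q j) * (z\<^sup>2 + 1) ^ j * z ^ (n - j)"
        by (metis mult.assoc mult.commute)
    qed simp
    finally show ?thesis .
  qed
  have "Q 0 = (\<Sum>j\<le>n. if j = n then of_real (coeff q j) else 0)"
    unfolding Q_def by (rule sum.cong) auto
  then have Q0: "Q 0 = of_real (coeff q n)" by simp
  have "((\<lambda>t. Q (circ t) * g (circ t)) has_integral Q 0 * g 0) {0..1}"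
    by (rule circle_mean_value) (auto simp: Q_def intro!: holomorphic_intros g)
  then have "((\<lambda>t. Re (Q (circ t) * g (circ t))) has_integral Re (Q 0 * g 0)) {0..1}"
    by (rule has_integral_Re)
  then show ?thesis
    by (rule has_integral_eq_rhs[OF has_integral_eq, rotated])
       (simp_all add: Q0 Q[symmetric] mult.assoc)
qed

text \<open>
  A right inverse of \<open>z \<mapsto> z + 1/z\<close> on the unit circle. Since \<open>sqrt\<close> is extended to negative
  arguments as an odd function, it is continuous on the whole line.
\<close>

definition zeta :: "real \<Rightarrow> complex" where
  "zeta x = Complex (x / 2) (sqrt (1 - (x / 2)\<^sup>2))"

lemma Re_zeta [simp]: "Re (zeta x) = x / 2"
  by (simp add: zeta_def)

lemma continuous_on_zeta: "continuous_on S zeta"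
  unfolding zeta_def[abs_def] Complex_eq by (intro continuous_intros) auto

lemma norm_zeta:
  assumes "x \<in> {-2..2}"
  shows "norm (zeta x) = 1"
proof -
  have "\<bar>x / 2\<bar> \<le> 1" using assms by auto
  then have "(x / 2)\<^sup>2 \<le> 1" using abs_square_le_1 by blast
  then show ?thesis by (simp add: zeta_def cmod_def)
qed

lemma zeta_Re:
  assumes "norm z = 1"
  shows "zeta (2 * Re z) = z \<or> zeta (2 * Re z) = cnj z"
proof -
  have "(Re z)\<^sup>2 + (Im z)\<^sup>2 = 1" using assms by (simp add: cmod_def)
  then have "1 - (Re z)\<^sup>2 = (Im z)\<^sup>2" by simp
  then have "zeta (2 * Re z) = Complex (Re z) \<bar>Im z\<bar>" by (simp add: zeta_def)
  then show ?thesis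
    by (cases "Im z \<ge> 0") (auto simp: complex_eq_iff)
qed

lemma unit_Re_range: "norm z = 1 \<Longrightarrow> 2 * Re z \<in> {-2..2}"
  using abs_Re_le_cmod[of z] by auto

text \<open>Symmetry under conjugation makes \<open>F\<close> a function of \<open>2 * Re z\<close>
  alone; \<open>zeta\<close> carries it continuously to the interval, where the Weierstrass theorem
  applies.\<close>

lemma poly_approx_circle:
  fixes F :: "complex \<Rightarrow> real"
  assumes cont: "continuous_on (sphere 0 1) F" and sym: "\<And>z. norm z = 1 \<Longrightarrow> F (cnj z) = F z"
    and "e > 0"
  obtains q where "\<And>z. norm z = 1 \<Longrightarrow> \<bar>F z - poly q (2 * Re z)\<bar> < e"
proof -
  have "continuous_on {-2..2} (\<lambda>x. F (zeta x))"
    by (rule continuous_on_compose2[OF cont continuous_on_zeta]) (use norm_zeta in auto)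
  then obtain g where g: "real_polynomial_function g" "\<And>x. x \<in> {-2..2} \<Longrightarrow> \<bar>F (zeta x) - g x\<bar> < e"
    using Stone_Weierstrass_real_polynomial_function[of "{-2..2::real}"] \<open>e > 0\<close> by blast
  from g(1) obtain c n where c: "g = (\<lambda>x. \<Sum>i\<le>n. c i * x ^ i)"
    unfolding real_polynomial_function_iff_sum by blast
  show ?thesis
  proof (rule that[of "\<Sum>i\<le>n. monom (c i) i"])
    fix z :: complex assume z: "norm z = 1"
    have "F (zeta (2 * Re z)) = F z" using zeta_Re[OF z] sym[OF z] by auto
    then show "\<bar>F z - poly (\<Sum>i\<le>n. monom (c i) i) (2 * Re z)\<bar> < e"
      using g(2)[OF unit_Re_range[OF z]] by (simp add: c poly_sum poly_monom)
  qed
qed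

section \<open>The Szego recursion\<close>

text \<open>
  The last clause lifts the trigonometric polynomials \<open>2 Re (z ^ (j - d) * a z)\<close> to the
  variable \<open>x = z + 1/z\<close>; these become the monic orthogonal polynomials.
\<close>

definition szego_pair :: "nat \<Rightarrow> (complex \<Rightarrow> complex) \<Rightarrow> (complex \<Rightarrow> complex) \<Rightarrow> bool" where
  "szego_pair d a b \<longleftrightarrow>
     a holomorphic_on UNIV \<and> b holomorphic_on UNIV \<and> b 0 = 1 \<and>
     (\<forall>z. cnj (a z) = a (cnj z)) \<and> (\<forall>z. cnj (b z) = b (cnj z)) \<and>
     (\<forall>z. norm z \<le> 1 \<longrightarrow> norm (a z) \<le> norm (b z) \<and> b z \<noteq> 0) \<and>
     (\<forall>z. norm z = 1 \<longrightarrow> b z = z ^ d * cnj (a z)) \<and>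
     (\<forall>j::int. \<exists>P::real poly. int (degree P) \<le> max j (int d - j) \<and>
        (2 * j > int d \<longrightarrow> coeff P (nat j) = 1) \<and>
        (\<forall>z. norm z = 1 \<longrightarrow> poly P (2 * Re z) = 2 * Re (z powi (j - int d) * a z)))"

lemma cnj_unit_mult:
  assumes "norm (z :: complex) = 1"
  shows "z * cnj z = 1" "cnj z * z = 1" "z ^ n * cnj z ^ n = 1" "inverse z = cnj z"
proof -
  show 1: "z * cnj z = 1"
    using assms by (simp add: complex_norm_square[symmetric])
  then show "cnj z * z = 1" by (simp add: mult.commute)
  show "z ^ n * cnj z ^ n = 1"
    by (simp add: power_mult_distrib[symmetric] 1)
  show "inverse z = cnj z"
    using 1 by (rule inverse_unique)
qed

text \<open>These are the Chebyshev polynomials in the normalisation that is monic on [-2, 2], built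
  by the three-term recursion coming from \<open>2 * Re z = z + cnj z\<close>. At degree 0 the lift
  is the constant 2, hence the guard \<open>n > 0\<close>.\<close>

lemma cheb_lift:
  "\<exists>P::real poly. degree P \<le> n \<and> (n > 0 \<longrightarrow> coeff P n = 1) \<and>
     (\<forall>z. norm z = 1 \<longrightarrow> poly P (2 * Re z) = 2 * Re (z ^ n))"
proof (induction n rule: nat_less_induct)
  case (1 n)
  consider "n = 0" | "n = 1" | m where "n = m + 2"
    by (metis One_nat_def add_2_eq_Suc' not0_implies_Suc)
  then show ?case
  proof cases
    assume "n = 0"
    then show ?thesis by (intro exI[of _ "[:2:]"]) auto
  next
    assume "n = 1"
    then show ?thesis by (intro exI[of _ "[:0, 1:]"]) auto
  next
    fix m assume n: "n = m + 2"
    from 1 n obtain P where P: "degree P \<le> m + 1" "coeff P (m + 1) = 1"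
      "\<And>z. norm z = 1 \<Longrightarrow> poly P (2 * Re z) = 2 * Re (z ^ (m + 1))"
      by (metis add_less_cancel_left less_add_one one_add_one add_is_0 gr0I one_neq_zero add.assoc add.commute)
    from 1 n obtain R where R: "degree R \<le> m"
      "\<And>z. norm z = 1 \<Longrightarrow> poly R (2 * Re z) = 2 * Re (z ^ m)"
      by (metis less_add_same_cancel1 pos2)
    show ?thesis
    proof (intro exI[of _ "pCons 0 P - R"] conjI allI impI)
      show "degree (pCons 0 P - R) \<le> n"
        using P(1) R(1) n by (intro degree_diff_le) (auto intro: order.trans[OF degree_pCons_le])
      show "coeff (pCons 0 P - R) n = 1"
        using P(2) R(1) n by (simp add: coeff_eq_0)
      fix z :: complex assume z: "norm z = 1"
      have "z ^ (m + 2) + cnj z * z * z ^ m = (z + cnj z) * z ^ (m + 1)"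
        by (simp add: algebra_simps)
      then have "z ^ (m + 2) + z ^ m = of_real (2 * Re z) * z ^ (m + 1)"
        by (simp only: cnj_unit_mult[OF z] complex_add_cnj) simp
      then have "Re (z ^ (m + 2)) + Re (z ^ m) = 2 * Re z * Re (z ^ (m + 1))"
        by (metis plus_complex.sel(1) Re_complex_of_real Im_complex_of_real times_complex.sel(1) mult_zero_left diff_zero)
      then show "poly (pCons 0 P - R) (2 * Re z) = 2 * Re (z ^ n)"
        unfolding n poly_diff poly_pCons P(3)[OF z] R(2)[OF z] by linarith
    qed
  qed
qed

lemma szego_pair_init: "szego_pair 1 (\<lambda>z. z) (\<lambda>_. 1)"
proof -
  have "\<exists>P::real poly. int (degree P) \<le> max j (int 1 - j) \<and>
        (2 * j > int 1 \<longrightarrow> coeff P (nat j) = 1) \<and>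
        (\<forall>z. norm z = 1 \<longrightarrow> poly P (2 * Re z) = 2 * Re (z powi (j - int 1) * z))" for j :: int
  proof -
    obtain P :: "real poly" where "degree P \<le> nat \<bar>j\<bar> \<and> (nat \<bar>j\<bar> > 0 \<longrightarrow> coeff P (nat \<bar>j\<bar>) = 1) \<and>
      (\<forall>z. norm z = 1 \<longrightarrow> poly P (2 * Re z) = 2 * Re (z ^ nat \<bar>j\<bar>))"
      using cheb_lift by blast
    then have P: "degree P \<le> nat \<bar>j\<bar>" "nat \<bar>j\<bar> > 0 \<Longrightarrow> coeff P (nat \<bar>j\<bar>) = 1"
      "\<And>z. norm z = 1 \<Longrightarrow> poly P (2 * Re z) = 2 * Re (z ^ nat \<bar>j\<bar>)"
      by simp_all
    show ?thesis
    proof (intro exI[of _ P] conjI allI impI)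
      show "int (degree P) \<le> max j (int 1 - j)" using P(1) by auto
      show "coeff P (nat j) = 1" if "2 * j > int 1" using P(2) that by auto
      fix z :: complex assume z: "norm z = 1"
      then have nz: "z \<noteq> 0" by auto
      have "z powi (j - int 1) * z = z powi j"
        using nz by (simp add: power_int_diff)
      moreover have "Re (z powi j) = Re (z ^ nat \<bar>j\<bar>)"
      proof (cases "j \<ge> 0")
        case False
        have "z powi j = cnj (z ^ nat \<bar>j\<bar>)"
          using False cnj_unit_mult(4)[OF z] by (simp add: power_int_def)
        then show ?thesis by (simp del: complex_cnj_power)
      qed (simp add: power_int_def)
      ultimately show "poly P (2 * Re z) = 2 * Re (z powi (j - int 1) * z)"
        using P(3)[OF z] by simp
    qed
  qed
  then show ?thesis
    unfolding szego_pair_def by (auto intro!: holomorphic_intros simp: cnj_unit_mult(1))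
qed

text \<open>For \<open>\<bar>r\<bar> < 1\<close> the sign of \<open>norm v - norm u\<close> passes
  to the new pair; this carries \<open>norm (a z) \<le> norm (b z)\<close> through the
  recursion.\<close>

lemma norm_diff_swap:
  fixes u v :: complex and r :: real
  shows "(norm (v - r * u))\<^sup>2 - (norm (u - r * v))\<^sup>2 = (1 - r\<^sup>2) * ((norm v)\<^sup>2 - (norm u)\<^sup>2)"
  unfolding cmod_power2 by (simp add: power2_eq_square algebra_simps)

lemma szego_pairD:
  assumes "szego_pair d a b"
  shows "a holomorphic_on S" "b holomorphic_on S" "b 0 = 1"
    "cnj (a z) = a (cnj z)" "cnj (b z) = b (cnj z)"
    "norm z \<le> 1 \<Longrightarrow> norm (a z) \<le> norm (b z)" "norm z \<le> 1 \<Longrightarrow> b z \<noteq> 0"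
    "norm z = 1 \<Longrightarrow> b z = z ^ d * cnj (a z)"
    "norm z = 1 \<Longrightarrow> norm (b z) = norm (a z)" "norm z = 1 \<Longrightarrow> a z \<noteq> 0"
    "continuous_on S a" "continuous_on S b"
proof -
  show 1: "a holomorphic_on S" "b holomorphic_on S" for S
    using assms holomorphic_on_subset unfolding szego_pair_def by blast+
  then show "continuous_on S a" "continuous_on S b"
    by (auto intro: holomorphic_on_imp_continuous_on)
  show "b 0 = 1" "cnj (a z) = a (cnj z)" "cnj (b z) = b (cnj z)"
    "norm z \<le> 1 \<Longrightarrow> norm (a z) \<le> norm (b z)" "norm z \<le> 1 \<Longrightarrow> b z \<noteq> 0"
    "norm z = 1 \<Longrightarrow> b z = z ^ d * cnj (a z)"
    using assms unfolding szego_pair_def by blast+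
  moreover have "norm (z ^ d * cnj (a z)) = norm (a z)" if "norm z = 1"
    using that by (simp only: norm_mult norm_power complex_mod_cnj) simp
  ultimately show 2: "norm z = 1 \<Longrightarrow> norm (b z) = norm (a z)"
    by presburger
  show "norm z = 1 \<Longrightarrow> a z \<noteq> 0"
    using 2 \<open>norm z \<le> 1 \<Longrightarrow> b z \<noteq> 0\<close> by (metis norm_eq_zero order_refl)
qed

lemma szego_pair_step:
  fixes r :: real and a b :: "complex \<Rightarrow> complex"
  assumes ab: "szego_pair d a b" and r: "\<bar>r\<bar> < 1" and m: "m > 0"
  shows "szego_pair (d + m) (\<lambda>z. z ^ m * a z - r * b z) (\<lambda>z. b z - r * (z ^ m * a z))"
proof -
  note D = szego_pairD[OF ab]
  have A: "norm (z ^ m * a z - r * b z) \<le> norm (b z - r * (z ^ m * a z)) \<and> b z - r * (z ^ m * a z) \<noteq> 0"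
    if z: "norm z \<le> 1" for z
  proof -
    define u where "u = z ^ m * a z"
    have "norm u \<le> 1 * norm (a z)"
      unfolding u_def norm_mult norm_power by (intro mult_right_mono power_le_one z) auto
    then have u: "norm u \<le> norm (b z)" using D(6)[OF z] by simp
    have "r\<^sup>2 \<le> 1" using r abs_square_le_1 by (meson less_imp_le)
    then have "0 \<le> (1 - r\<^sup>2) * ((norm (b z))\<^sup>2 - (norm u)\<^sup>2)"
      using u by (intro mult_nonneg_nonneg) auto
    then have "(norm (u - r * b z))\<^sup>2 \<le> (norm (b z - r * u))\<^sup>2"
      using norm_diff_swap[of "b z" r u] by linarith
    then have 1: "norm (u - r * b z) \<le> norm (b z - r * u)"
      by (rule power2_le_imp_le) simp
    have "b z \<noteq> 0" using D(7)[OF z] .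
    then have "\<bar>r\<bar> * norm (b z) < 1 * norm (b z)"
      using r by (intro mult_strict_right_mono) auto
    moreover have "\<bar>r\<bar> * norm u \<le> \<bar>r\<bar> * norm (b z)"
      using u by (intro mult_left_mono) auto
    ultimately have "norm (r * u) < norm (b z)"
      by (simp add: norm_mult)
    then have "b z - r * u \<noteq> 0" by auto
    with 1 show ?thesis by (simp add: u_def)
  qed
  have B: "b z - r * (z ^ m * a z) = z ^ (d + m) * cnj (z ^ m * a z - r * b z)"
    if z: "norm z = 1" for z
  proof -
    have bz: "b z = z ^ d * cnj (a z)" by (rule D(8)[OF z])
    have "z ^ (d + m) * cnj (z ^ m * a z - r * b z)
      = (z ^ m * cnj z ^ m) * (z ^ d * cnj (a z)) - r * (z ^ m * ((z ^ d * cnj z ^ d) * a z))"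
      unfolding bz by (simp add: power_add algebra_simps)
    then show ?thesis by (simp add: cnj_unit_mult[OF z] bz)
  qed
  have C: "\<exists>P::real poly. int (degree P) \<le> max j (int (d + m) - j) \<and>
        (2 * j > int (d + m) \<longrightarrow> coeff P (nat j) = 1) \<and>
        (\<forall>z. norm z = 1 \<longrightarrow> poly P (2 * Re z)
           = 2 * Re (z powi (j - int (d + m)) * (z ^ m * a z - r * b z)))" for j :: int
  proof -
    have lift: "\<exists>P::real poly. int (degree P) \<le> max i (int d - i) \<and>
        (2 * i > int d \<longrightarrow> coeff P (nat i) = 1) \<and>
        (\<forall>z. norm z = 1 \<longrightarrow> poly P (2 * Re z) = 2 * Re (z powi (i - int d) * a z))" for i
      using ab unfolding szego_pair_def by blast
    obtain P :: "real poly" where P: "int (degree P) \<le> max j (int d - j)"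
        "2 * j > int d \<longrightarrow> coeff P (nat j) = 1"
        "\<And>z. norm z = 1 \<Longrightarrow> poly P (2 * Re z) = 2 * Re (z powi (j - int d) * a z)"
      using lift by blast
    \<comment> \<open>Reversal turns the \<open>b\<close> term into the lift of \<open>a\<close> at
      the reflected index \<open>i\<close>, which may be small or negative; this is why the lift
      clause ranges over all integers \<open>j\<close>. When \<open>2 * j > d + m\<close>, that lift
      has degree below \<open>j\<close>, so the leading coefficient 1 survives.\<close>
    define i where "i = int m + int d - j"
    obtain R :: "real poly" where R: "int (degree R) \<le> max i (int d - i)"
        "\<And>z. norm z = 1 \<Longrightarrow> poly R (2 * Re z) = 2 * Re (z powi (i - int d) * a z)"
      using lift by blast
    show ?thesis
    proof (intro exI[of _ "P - smult r R"] conjI allI impI)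
      have "int (degree (smult r R)) \<le> max i (int d - i)"
        using R(1) degree_smult_le[of r R] by linarith
      then have "int (max (degree P) (degree (smult r R))) \<le> max j (int (d + m) - j)"
        using P(1) by (auto simp: i_def)
      then show "int (degree (P - smult r R)) \<le> max j (int (d + m) - j)"
        using degree_diff_le_max[of P "smult r R"] by linarith
      show "coeff (P - smult r R) (nat j) = 1" if "2 * j > int (d + m)"
      proof -
        have "degree R < nat j" using R(1) that m by (auto simp: i_def)
        then show ?thesis using P(2) that by (simp add: coeff_eq_0)
      qed
      fix z :: complex assume z: "norm z = 1"
      then have nz: "z \<noteq> 0" by auto
      have 1: "z powi (j - int (d + m)) * (z ^ m * a z) = z powi (j - int d) * a z"
        using nz by (simp add: power_int_diff power_int_add)
      have 2: "Re (z powi (j - int (d + m)) * b z) = Re (z powi (i - int d) * a z)"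
      proof -
        have "z powi (j - int (d + m)) * b z = z powi (j - int m) * cnj (a z)"
          unfolding D(8)[OF z] using nz by (simp add: power_int_diff power_int_add)
        also have "z powi (j - int m) = inverse (z powi (i - int d))"
          using nz by (simp add: power_int_minus[symmetric] i_def)
        also have "\<dots> = cnj (z powi (i - int d))"
          by (rule cnj_unit_mult(4)) (simp add: norm_power_int z)
        finally show ?thesis by (metis complex_cnj_mult cnj.sel(1))
      qed
      have "Re (z powi (j - int (d + m)) * (z ^ m * a z - r * b z))
          = Re (z powi (j - int d) * a z) - r * Re (z powi (i - int d) * a z)"
      proof -
        have "u * (v - r * w) = u * v - r *\<^sub>R (u * w)" for u v w :: complex
          by (simp add: scaleR_conv_of_real algebra_simps)
        then show ?thesis
          by (simp only: 1 2 minus_complex.sel scaleR_complex.sel)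
      qed
      then show "poly (P - smult r R) (2 * Re z)
          = 2 * Re (z powi (j - int (d + m)) * (z ^ m * a z - r * b z))"
        using P(3)[OF z] R(2)[OF z] by simp
    qed
  qed
  show ?thesis
    unfolding szego_pair_def
  proof (intro conjI allI impI)
    show "(\<lambda>z. z ^ m * a z - r * b z) holomorphic_on UNIV"
      "(\<lambda>z. b z - r * (z ^ m * a z)) holomorphic_on UNIV"
      by (intro holomorphic_intros D)+
    show "b 0 - r * (0 ^ m * a 0) = 1" using D(3) m by simp
    fix z
    show "cnj (z ^ m * a z - r * b z) = cnj z ^ m * a (cnj z) - r * b (cnj z)"
      "cnj (b z - r * (z ^ m * a z)) = b (cnj z) - r * (cnj z ^ m * a (cnj z))"
      by (simp_all add: D(4,5))
    show "norm z \<le> 1 \<Longrightarrow> norm (z ^ m * a z - r * b z) \<le> norm (b z - r * (z ^ m * a z))"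
      "norm z \<le> 1 \<Longrightarrow> b z - r * (z ^ m * a z) \<noteq> 0"
      using A by blast+
    show "norm z = 1 \<Longrightarrow> b z - r * (z ^ m * a z) = z ^ (d + m) * cnj (z ^ m * a z - r * b z)"
      by (rule B)
  next
    fix j :: int
    show "\<exists>P::real poly. int (degree P) \<le> max j (int (d + m) - j) \<and>
        (2 * j > int (d + m) \<longrightarrow> coeff P (nat j) = 1) \<and>
        (\<forall>z. norm z = 1 \<longrightarrow> poly P (2 * Re z)
           = 2 * Re (z powi (j - int (d + m)) * (z ^ m * a z - r * b z)))"
      by (rule C)
  qed
qed

text \<open>Consecutive densities differ by the real part of \<open>z ^ (d + m)\<close> times a
  function holomorphic on the closed disc, as \<open>b\<close> and \<open>b'\<close> have no zeros
  there. Against polynomials in \<open>2 * Re z\<close> of degree below \<open>d + m\<close> such a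
  term integrates to 0, which is what freezes the low moments.\<close>

lemma szego_density_diff:
  fixes r :: real and a b :: "complex \<Rightarrow> complex"
  assumes ab: "szego_pair d a b" and r: "\<bar>r\<bar> < 1" and m: "m > 0" and z: "norm z = 1"
  defines "b' \<equiv> b z - r * (z ^ m * a z)"
  shows "(1 - r\<^sup>2) / (norm (z ^ m * a z - r * b z))\<^sup>2 - 1 / (norm (a z))\<^sup>2
    = 2 * r * Re (z ^ (d + m) * (1 / (b z * b')))"
proof -
  note D = szego_pairD[OF ab]
  note D' = szego_pairD[OF szego_pair_step[OF ab r m]]
  define u where "u = z ^ m * a z"
  have nu: "norm u = norm (b z)" "norm (a z) = norm (b z)" using D(9)[OF z] z by (auto simp: u_def norm_mult norm_power)
  have nb': "norm (u - r * b z) = norm b'"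
    using D'(9)[OF z] by (simp add: u_def b'_def)
  have nz: "b z \<noteq> 0" "b' \<noteq> 0" using D(7) D'(7) z by (auto simp: b'_def)
  have "cnj (b z) * z ^ (d + m) = (z ^ d * cnj z ^ d) * (z ^ m * a z)"
    unfolding D(8)[OF z] by (simp add: power_add)
  then have 1: "cnj (b z) * z ^ (d + m) = u"
    by (simp add: cnj_unit_mult[OF z] u_def)
  have "z ^ (d + m) * (1 / (b z * b'))
      = (cnj (b z) * z ^ (d + m)) * cnj b' / ((b z * cnj (b z)) * (b' * cnj b'))"
    using nz by (simp add: field_simps)
  also have "\<dots> = u * cnj b' / of_real ((norm (b z))\<^sup>2 * (norm b')\<^sup>2)"
    by (simp only: 1 of_real_mult complex_norm_square)
  finally have 2: "Re (z ^ (d + m) * (1 / (b z * b'))) = Re (u * cnj b') / ((norm (b z))\<^sup>2 * (norm b')\<^sup>2)"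
    by (simp only: Re_divide_of_real)
  have b'u: "b' = b z - r * u" by (simp add: b'_def u_def)
  have "Re (u * cnj b') = Re (u * cnj (b z)) - r * (norm u)\<^sup>2"
    unfolding b'u cmod_power2 by (simp add: power2_eq_square algebra_simps)
  moreover have "(norm b')\<^sup>2 = (norm (b z))\<^sup>2 - 2 * r * Re (u * cnj (b z)) + r\<^sup>2 * (norm u)\<^sup>2"
    unfolding b'u cmod_power2 by (simp add: power2_eq_square algebra_simps)
  ultimately have 3: "(1 - r\<^sup>2) * (norm (b z))\<^sup>2 - (norm b')\<^sup>2 = 2 * r * Re (u * cnj b')"
    unfolding nu by algebra
  have "(1 - r\<^sup>2) / (norm b')\<^sup>2 - 1 / (norm (b z))\<^sup>2
      = ((1 - r\<^sup>2) * (norm (b z))\<^sup>2 - (norm b')\<^sup>2) / ((norm (b z))\<^sup>2 * (norm b')\<^sup>2)"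
    using nz by (simp add: field_simps)
  then show ?thesis
    unfolding 2 3 using nb' nu by (simp add: u_def)
qed

section \<open>Decay of the Hellinger integral\<close>

text \<open>The generating function of the Legendre polynomials gives 1 + r c + (3 c^2 - 1) r^2 / 2
  to second order. Taking -3/8 in place of -1/2 leaves a slack of r^2 / 8, which absorbs all higher
  terms when \<open>r \<le> 1/40\<close>.\<close>

lemma inverse_sqrt_bound:
  fixes r c :: real
  assumes r: "0 \<le> r" "r \<le> 1/40" and c: "\<bar>c\<bar> \<le> 1"
  shows "1 / sqrt (1 - 2 * r * c + r\<^sup>2) \<le> 1 + r * c + 3/2 * r\<^sup>2 * c\<^sup>2 - 3/8 * r\<^sup>2"
proof -
  define s e where "s = r * c" and "e = r\<^sup>2"
  define U D where "U = 1 + s + 3/2 * s\<^sup>2 - 3/8 * e" and "D = 1 - 2 * s + e"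
  have "\<bar>s\<bar> \<le> r * 1" unfolding s_def abs_mult using r c by (intro mult_mono) auto
  then have s: "\<bar>s\<bar> \<le> 1/40" using r by simp
  have "c\<^sup>2 \<le> 1" using c abs_square_le_1 by blast
  then have se: "s\<^sup>2 \<le> e" unfolding s_def e_def power_mult_distrib by (simp add: mult_left_le)
  have "e \<le> (1/40)\<^sup>2" unfolding e_def using r by (intro power_mono) auto
  then have e: "0 \<le> e" "e \<le> 1/40" by (auto simp: e_def power2_eq_square)
  have pow: "\<bar>s ^ k\<bar> \<le> 1/40" if "k > 0" for k
  proof -
    have "\<bar>s\<bar> ^ k \<le> \<bar>s\<bar> ^ 1" using that s by (intro power_decreasing) auto
    then show ?thesis using s by (simp add: power_abs)
  qed
  have prod: "\<bar>x * y\<bar> \<le> 1/1600" if "\<bar>x\<bar> \<le> 1/40" "\<bar>y\<bar> \<le> 1/40" for x y :: real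
    using mult_mono[OF that] by (simp add: abs_mult)
  have p2: "\<bar>s\<^sup>2\<bar> \<le> 1/1600" "\<bar>s ^ 3\<bar> \<le> 1/1600" "\<bar>s ^ 4\<bar> \<le> 1/1600" "\<bar>e * s\<bar> \<le> 1/1600"
     "\<bar>e * s\<^sup>2\<bar> \<le> 1/1600" "\<bar>e\<^sup>2\<bar> \<le> 1/1600"
    using prod[OF s s] prod[OF s pow[of 2]] prod[OF s pow[of 3]] prod[of e s] prod[of e "s\<^sup>2"]
      prod[of e e] e s pow[of 2]
    by (simp_all add: power2_eq_square power3_eq_cube power4_eq_xxxx mult.assoc)
  \<comment> \<open>\<open>A\<close> and \<open>B\<close> sort the expansion of
    \<open>U\<^sup>2 * D - 1\<close> as \<open>s\<^sup>2 * A + e * B\<close>. Agreement to second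
    order leaves \<open>A\<close> without a constant term, while the slack puts 1/4 into
    \<open>B\<close>. As \<open>s\<^sup>2 \<le> e\<close>, the lower bound of \<open>B\<close>
    compensates that of \<open>A\<close>.\<close>
  define A B where "A = -5 * s - 15/4 * s\<^sup>2 - 9/2 * s ^ 3"
    and "B = 1/4 + 11/4 * s + 35/8 * s\<^sup>2 + 21/4 * s ^ 3 + 9/4 * s ^ 4 - 39/64 * e - 33/32 * (e * s)
        - 9/8 * (e * s\<^sup>2) + 9/64 * e\<^sup>2"
  have "e \<le> 1/1600" using \<open>e \<le> (1/40)\<^sup>2\<close> by (simp add: power2_eq_square)
  then have AB: "A \<ge> -(7/50)" "B \<ge> 7/50" using p2 s e unfolding A_def B_def by linarith+
  have "U\<^sup>2 * D - 1 = s\<^sup>2 * A + e * B"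
    unfolding U_def D_def A_def B_def by (simp add: field_simps power2_eq_square power3_eq_cube power4_eq_xxxx)
  moreover have "s\<^sup>2 * A \<ge> s\<^sup>2 * -(7/50)" using AB by (intro mult_left_mono) auto
  moreover have "e * B \<ge> e * (7/50)" using AB e by (intro mult_left_mono) auto
  ultimately have UD: "U\<^sup>2 * D \<ge> 1" using se by linarith
  have U: "U > 0" using p2 s e unfolding U_def by linarith
  have D: "D > 0" using s e unfolding D_def by linarith
  have "1 \<le> sqrt (U\<^sup>2 * D)" using UD by simp
  also have "\<dots> = U * sqrt D" using U by (simp add: real_sqrt_mult)
  finally have "1 / sqrt D \<le> U" using D by (simp add: field_simps)
  moreover have "1 - 2 * r * c + r\<^sup>2 = D" by (simp add: D_def s_def e_def)
  moreover have "1 + r * c + 3/2 * r\<^sup>2 * c\<^sup>2 - 3/8 * r\<^sup>2 = U" by (simp add: U_def s_def e_def power_mult_distrib)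
  ultimately show ?thesis by simp
qed

lemma continuous_on_circ_compose:
  "continuous_on (sphere 0 1) f \<Longrightarrow> continuous_on S (\<lambda>t. f (circ t))"
  by (rule continuous_on_compose2[OF _ continuous_on_circ]) auto

lemma circ_integrable:
  fixes f :: "complex \<Rightarrow> real"
  shows "continuous_on (sphere 0 1) f \<Longrightarrow> (\<lambda>t. f (circ t)) integrable_on {0..1}"
  by (intro integrable_continuous_real continuous_on_circ_compose)

text \<open>On the circle \<open>w = z ^ m * a z / b z\<close> is unimodular and the new polynomial
  equals \<open>b z * (w - r)\<close>. Writing the square of \<open>Re w\<close> through
  \<open>Re (w\<^sup>2)\<close> splits the bound into a mean part, with 3/4 - 3/8 = 3/8, and two
  terms that oscillate like \<open>z ^ m\<close> and \<open>z ^ (2 * m)\<close>.\<close>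

lemma hellinger_pointwise:
  fixes r :: real and a b :: "complex \<Rightarrow> complex"
  assumes ab: "szego_pair d a b" and r: "0 \<le> r" "r \<le> 1/40" and z: "norm z = 1"
  defines "g \<equiv> a z / b z"
  shows "1 / norm (z ^ m * a z - r * b z) \<le> (1 + 3/8 * r\<^sup>2) * (1 / norm (a z))
     + r * (1 / norm (a z) * Re (z ^ m * g)) + 3/4 * r\<^sup>2 * (1 / norm (a z) * Re (z ^ (2 * m) * g\<^sup>2))"
proof -
  note D = szego_pairD[OF ab]
  define w where "w = z ^ m * g"
  have nz: "b z \<noteq> 0" "a z \<noteq> 0" using D(7,10) z by auto
  have nw: "norm w = 1"
    using nz D(9)[OF z] by (simp add: w_def g_def norm_mult norm_divide norm_power z)
  have w: "(Re w)\<^sup>2 + (Im w)\<^sup>2 = 1" using nw by (simp add: cmod_def)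
  have "Re (w\<^sup>2) = (Re w)\<^sup>2 - (Im w)\<^sup>2" by (simp add: power2_eq_square)
  then have Re2: "(Re w)\<^sup>2 = (1 + Re (w\<^sup>2)) / 2" using w by simp
  have "z ^ m * a z - r * b z = b z * (w - r)"
    using nz by (simp add: w_def g_def algebra_simps)
  then have "norm (z ^ m * a z - r * b z) = norm (a z) * norm (w - r)"
    using D(9)[OF z] by (simp add: norm_mult)
  moreover have "norm (w - r) = sqrt (1 - 2 * r * Re w + r\<^sup>2)"
  proof -
    have "(Re w - r)\<^sup>2 + (Im w)\<^sup>2 = 1 - 2 * r * Re w + r\<^sup>2"
      using w by (simp add: power2_diff)
    then show ?thesis by (simp add: cmod_def)
  qed
  ultimately have "1 / norm (z ^ m * a z - r * b z)
      = 1 / norm (a z) * (1 / sqrt (1 - 2 * r * Re w + r\<^sup>2))" by simp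
  also have "\<dots> \<le> 1 / norm (a z) * (1 + r * Re w + 3/2 * r\<^sup>2 * (Re w)\<^sup>2 - 3/8 * r\<^sup>2)"
    using abs_Re_le_cmod[of w] nw r by (intro mult_left_mono inverse_sqrt_bound) auto
  also have "\<dots> = (1 + 3/8 * r\<^sup>2) * (1 / norm (a z))
     + r * (1 / norm (a z) * Re w) + 3/4 * r\<^sup>2 * (1 / norm (a z) * Re (w\<^sup>2))"
    unfolding Re2 by (simp add: algebra_simps)
  also have "w\<^sup>2 = z ^ (2 * m) * g\<^sup>2"
    by (simp add: w_def power_mult_distrib power_mult[symmetric] mult.commute)
  finally show ?thesis by (simp add: w_def)
qed

text \<open>
  The analytic factor \<open>z ^ M * g z\<close> is orthogonal to polynomials in \<open>Re z\<close> of degree below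
  \<open>M\<close>, so only the approximation error contributes.
\<close>

lemma oscillating_integral_small:
  assumes F: "continuous_on (sphere 0 1) F" and q: "\<And>z. norm z = 1 \<Longrightarrow> \<bar>F z - poly q (2 * Re z)\<bar> < e"
    and g: "g holomorphic_on cball 0 1" "\<And>z. norm z = 1 \<Longrightarrow> norm (g z) \<le> 1" and M: "M > degree q"
  shows "integral {0..1} (\<lambda>t. F (circ t) * Re (circ t ^ M * g (circ t))) \<le> e"
proof -
  have [continuous_intros]: "continuous_on (sphere 0 1) g"
    using g(1) holomorphic_on_imp_continuous_on holomorphic_on_subset
    by (metis sphere_cball)
  have 0: "((\<lambda>t. poly q (2 * Re (circ t)) * Re (circ t ^ M * g (circ t))) has_integral 0) {0..1}"
    using circle_integral_poly[OF g(1), of q M] M by (simp add: coeff_eq_0)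
  have *: "(\<lambda>t. F (circ t) * Re (circ t ^ M * g (circ t))) integrable_on {0..1}"
    by (rule circ_integrable) (intro continuous_intros F)
  then have "((\<lambda>t. F (circ t) * Re (circ t ^ M * g (circ t)) - poly q (2 * Re (circ t)) * Re (circ t ^ M * g (circ t)))
      has_integral (integral {0..1} (\<lambda>t. F (circ t) * Re (circ t ^ M * g (circ t))) - 0)) {0..1}"
    by (intro has_integral_diff 0 integrable_integral)
  moreover have "((\<lambda>t. e) has_integral e) {0..1::real}"
    using has_integral_const_real[of e 0 1] by simp
  ultimately have "integral {0..1} (\<lambda>t. F (circ t) * Re (circ t ^ M * g (circ t))) - 0 \<le> e"
  proof (rule has_integral_le)
    fix t :: real
    define z where "z = circ t"
    have z: "norm z = 1" by (simp add: z_def)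
    have "norm (z ^ M * g z) \<le> 1" using g(2)[OF z] z by (simp add: norm_mult norm_power)
    then have "\<bar>Re (z ^ M * g z)\<bar> \<le> 1" using abs_Re_le_cmod order.trans by blast
    then have "\<bar>(F z - poly q (2 * Re z)) * Re (z ^ M * g z)\<bar> \<le> e * 1"
      unfolding abs_mult using q[OF z] by (intro mult_mono) auto
    then show "F (circ t) * Re (circ t ^ M * g (circ t)) - poly q (2 * Re (circ t)) * Re (circ t ^ M * g (circ t)) \<le> e"
      unfolding z_def[symmetric] left_diff_distrib by linarith
  qed
  then show ?thesis by simp
qed

text \<open>Count the multiples of \<open>r\<^sup>2\<close>: the mean part gains 3/8, the two
  oscillating terms at most 1/16 together, and \<open>sqrt (1 - r\<^sup>2)\<close> loses 1/2. A net
  loss of 1/16 remains.\<close>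

lemma hellinger_step:
  fixes r :: real and a b :: "complex \<Rightarrow> complex"
  assumes ab: "szego_pair d a b" and r: "0 < r" "r \<le> 1/40"
  shows "\<forall>\<^sub>F m in sequentially.
    sqrt (1 - r\<^sup>2) * integral {0..1} (\<lambda>t. 1 / norm (circ t ^ m * a (circ t) - r * b (circ t)))
      \<le> (1 - r\<^sup>2 / 16) * integral {0..1} (\<lambda>t. 1 / norm (a (circ t)))"
proof -
  note D = szego_pairD[OF ab]
  define F where "F z = 1 / norm (a z)" for z
  define g where "g z = a z / b z" for z
  define I where "I = integral {0..1} (\<lambda>t. F (circ t))"
  have contF: "continuous_on (sphere 0 1) F"
    unfolding F_def by (intro continuous_intros D) (use D(10) in auto)
  have "compact (F ` sphere 0 1)" "F ` sphere 0 1 \<noteq> {}"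
    by (intro compact_continuous_image contF) auto
  then obtain z0 where z0: "norm z0 = 1" "\<And>z. norm z = 1 \<Longrightarrow> F z0 \<le> F z"
    using compact_attains_inf[of "F ` sphere 0 1"] by auto
  have F0: "F z0 > 0" using D(10) z0 by (auto simp: F_def)
  have intF: "(\<lambda>t. F (circ t)) integrable_on {0..1}" by (rule circ_integrable[OF contF])
  have "integral {0..1} (\<lambda>t::real. F z0) \<le> I"
    unfolding I_def by (rule integral_le) (use intF z0 in auto)
  then have I: "I > 0" using F0 by simp
  have "F (cnj z) = F z" for z
    by (simp add: F_def D(4)[symmetric])
  \<comment> \<open>The tolerance contains a factor \<open>r\<close> because the first oscillating
    term has weight only \<open>r\<close>, while its contribution has to be of order
    \<open>r\<^sup>2\<close>.\<close>
  then obtain q where q: "\<And>z. norm z = 1 \<Longrightarrow> \<bar>F z - poly q (2 * Re z)\<bar> < r * I / 32"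
    using poly_approx_circle[OF contF, of "r * I / 32"] r I by auto
  have g: "g holomorphic_on cball 0 1"
    unfolding g_def by (intro holomorphic_intros D) (use D(7) in auto)
  have ng: "norm (g z) = 1" if "norm z = 1" for z
    using D(9,10) that by (simp add: g_def norm_divide)
  have contg: "continuous_on (sphere 0 1) g"
    using g holomorphic_on_imp_continuous_on holomorphic_on_subset by (metis sphere_cball)
  have main: "sqrt (1 - r\<^sup>2) * integral {0..1} (\<lambda>t. 1 / norm (circ t ^ m * a (circ t) - r * b (circ t)))
      \<le> (1 - r\<^sup>2 / 16) * I" if m: "m > degree q" for m
  proof -
    define J1 J2 where "J1 = integral {0..1} (\<lambda>t. F (circ t) * Re (circ t ^ m * g (circ t)))"
      and "J2 = integral {0..1} (\<lambda>t. F (circ t) * Re (circ t ^ (2 * m) * (g (circ t))\<^sup>2))"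
    have J1: "J1 \<le> r * I / 32" unfolding J1_def
      by (rule oscillating_integral_small[OF contF q g]) (use ng m in auto)
    have J2: "J2 \<le> r * I / 32" unfolding J2_def
      by (rule oscillating_integral_small[OF contF q, of "\<lambda>z. (g z)\<^sup>2"])
         (use ng m in \<open>auto intro!: holomorphic_intros g simp: norm_power\<close>)
    define T where "T = (\<lambda>t. (1 + 3/8 * r\<^sup>2) * F (circ t) + r * (F (circ t) * Re (circ t ^ m * g (circ t)))
       + 3/4 * r\<^sup>2 * (F (circ t) * Re (circ t ^ (2 * m) * (g (circ t))\<^sup>2)))"
    have i1: "(\<lambda>t. F (circ t) * Re (circ t ^ m * g (circ t))) integrable_on {0..1}"
      by (rule circ_integrable) (intro continuous_intros contF contg)
    have i2: "(\<lambda>t. F (circ t) * Re (circ t ^ (2 * m) * (g (circ t))\<^sup>2)) integrable_on {0..1}"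
      by (rule circ_integrable) (intro continuous_intros contF contg)
    have T: "(T has_integral (1 + 3/8 * r\<^sup>2) * I + r * J1 + 3/4 * r\<^sup>2 * J2) {0..1}"
      unfolding T_def I_def J1_def J2_def
      by (intro has_integral_add has_integral_mult_right integrable_integral intF i1 i2)
    have step: "szego_pair (d + Suc m) (\<lambda>z. z ^ Suc m * a z - r * b z) (\<lambda>z. b z - r * (z ^ Suc m * a z))" for m
      by (rule szego_pair_step[OF ab]) (use r in auto)
    have "z ^ m * a z - r * b z \<noteq> 0" if "norm z = 1" for z
      using szego_pairD(10)[OF step that, of "m - 1"] m by simp
    then have "(\<lambda>t. 1 / norm (circ t ^ m * a (circ t) - r * b (circ t))) integrable_on {0..1}"
      by (intro circ_integrable[of "\<lambda>z. 1 / norm (z ^ m * a z - r * b z)"] continuous_intros D) auto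
    then have "integral {0..1} (\<lambda>t. 1 / norm (circ t ^ m * a (circ t) - r * b (circ t)))
        \<le> (1 + 3/8 * r\<^sup>2) * I + r * J1 + 3/4 * r\<^sup>2 * J2" (is "?L \<le> _")
    proof (rule has_integral_le[OF integrable_integral T])
      fix t :: real
      show "1 / norm (circ t ^ m * a (circ t) - r * b (circ t)) \<le> T t"
        unfolding T_def F_def g_def by (rule hellinger_pointwise[OF ab]) (use r in auto)
    qed
    moreover have "r * J1 \<le> r * (r * I / 32)" using J1 r by (intro mult_left_mono) auto
    moreover have "3/4 * r\<^sup>2 * J2 \<le> r * (r * I / 32)"
    proof -
      have "3/4 * r\<^sup>2 * J2 \<le> 3/4 * r\<^sup>2 * (r * I / 32)" using J2 by (intro mult_left_mono) auto
      also have "\<dots> \<le> r * (r * I / 32)"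
        using r I by (intro mult_right_mono) (auto simp: power2_eq_square)
      finally show ?thesis .
    qed
    ultimately have L: "?L \<le> (1 + 7/16 * r\<^sup>2) * I"
      by (simp add: algebra_simps power2_eq_square)
    have r2: "r\<^sup>2 \<le> 1" using r abs_square_le_1[of r] by auto
    have "1 - r\<^sup>2 \<le> (1 - r\<^sup>2 / 2)\<^sup>2" by (simp add: power2_diff)
    then have sq: "sqrt (1 - r\<^sup>2) \<le> 1 - r\<^sup>2 / 2"
      using r2 by (intro real_le_lsqrt) auto
    have "sqrt (1 - r\<^sup>2) * ?L \<le> sqrt (1 - r\<^sup>2) * ((1 + 7/16 * r\<^sup>2) * I)"
      using L r2 by (intro mult_left_mono) auto
    also have "\<dots> \<le> (1 - r\<^sup>2 / 2) * ((1 + 7/16 * r\<^sup>2) * I)"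
      using sq I by (intro mult_right_mono) auto
    also have "\<dots> = ((1 - r\<^sup>2 / 2) * (1 + 7/16 * r\<^sup>2)) * I" by simp
    also have "\<dots> \<le> (1 - r\<^sup>2 / 16) * I"
      using I by (intro mult_right_mono) (auto simp: algebra_simps)
    finally show ?thesis .
  qed
  show ?thesis
    unfolding eventually_sequentially using main unfolding I_def F_def
    by (intro exI[of _ "Suc (degree q)"]) (auto simp: Suc_le_eq)
qed

section \<open>Sparse Szego recursions and their measures\<close>

definition circle_measure :: "(complex \<Rightarrow> real) \<Rightarrow> real measure" where
  "circle_measure w =
     distr (density lborel (\<lambda>t. ennreal (indicator {0..1} t * w (circ t)))) borel (\<lambda>t. 2 * Re (circ t))"

lemma circle_measure_integral:
  fixes \<phi> :: "real \<Rightarrow> real"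
  assumes w: "continuous_on (sphere 0 1) w" "\<And>z. norm z = 1 \<Longrightarrow> w z \<ge> 0" and \<phi>: "continuous_on UNIV \<phi>"
  shows "integrable (circle_measure w) \<phi>"
    and "(\<integral>x. \<phi> x \<partial>circle_measure w) = integral {0..1} (\<lambda>t. w (circ t) * \<phi> (2 * Re (circ t)))"
proof -
  have wc: "continuous_on S (\<lambda>t. w (circ t))" for S
    by (rule continuous_on_circ_compose[OF w(1)])
  have rc: "continuous_on S (\<lambda>t. 2 * Re (circ t))" for S
    by (intro continuous_intros)
  have pc: "continuous_on S (\<lambda>t. \<phi> (2 * Re (circ t)))" for S
    by (rule continuous_on_compose2[OF \<phi> rc]) auto
  have [measurable]: "(\<lambda>t. w (circ t)) \<in> borel_measurable borel" "(\<lambda>t. 2 * Re (circ t)) \<in> borel_measurable borel"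
      "\<phi> \<in> borel_measurable borel"
    using wc rc \<phi> by (auto intro: borel_measurable_continuous_onI)
  have nn: "AE t in lborel. 0 \<le> indicator {0..1} t * w (circ t)"
    using w(2) by (auto simp: indicator_def)
  have si: "set_integrable lborel {0..1} (\<lambda>t. w (circ t) * \<phi> (2 * Re (circ t)))"
    by (intro borel_integrable_atLeastAtMost' continuous_intros wc pc)
  then have "integrable lborel (\<lambda>t. (indicator {0..1} t * w (circ t)) *\<^sub>R \<phi> (2 * Re (circ t)))"
    unfolding set_integrable_def by (simp add: mult.assoc)
  then show "integrable (circle_measure w) \<phi>"
    unfolding circle_measure_def using nn
    by (subst integrable_distr_eq; (subst integrable_density)?) auto
  have "(\<integral>x. \<phi> x \<partial>circle_measure w)
      = (\<integral>t. (indicator {0..1} t * w (circ t)) *\<^sub>R \<phi> (2 * Re (circ t)) \<partial>lborel)"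
    unfolding circle_measure_def using nn
    by (subst integral_distr; (subst integral_density)?) auto
  also have "\<dots> = (LINT t:{0..1}|lborel. w (circ t) * \<phi> (2 * Re (circ t)))"
    unfolding set_lebesgue_integral_def by (simp add: mult.assoc)
  finally show "(\<integral>x. \<phi> x \<partial>circle_measure w) = integral {0..1} (\<lambda>t. w (circ t) * \<phi> (2 * Re (circ t)))"
    by (simp add: set_borel_integral_eq_integral(2)[OF si])
qed

lemma circle_measure_real_distribution:
  assumes w: "continuous_on (sphere 0 1) w" "\<And>z. norm z = 1 \<Longrightarrow> w z \<ge> 0"
    and one: "integral {0..1} (\<lambda>t. w (circ t)) = 1"
  shows "real_distribution (circle_measure w)"
proof -
  have "integrable (circle_measure w) (\<lambda>_. 1::real)"
    by (rule circle_measure_integral(1)[OF w]) auto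
  moreover have "(\<integral>x. 1 \<partial>circle_measure w) = integral {0..1} (\<lambda>t. w (circ t) * 1)"
    by (rule circle_measure_integral(2)[OF w]) auto
  ultimately have "(\<integral>\<^sup>+x. ennreal 1 \<partial>circle_measure w) = 1"
    using one by (subst nn_integral_eq_integral) (simp_all only: mult_1_right, auto)
  then have "prob_space (circle_measure w)"
    by (intro prob_spaceI) simp
  then show ?thesis
    by (simp add: real_distribution_def real_distribution_axioms_def circle_measure_def)
qed

lemma emeasure_circle_measure_outside:
  assumes "continuous_on (sphere 0 1) w"
  shows "emeasure (circle_measure w) (- {-2..2}) = 0"
proof -
  have [measurable]: "(\<lambda>t. w (circ t)) \<in> borel_measurable borel" "(\<lambda>t. 2 * Re (circ t)) \<in> borel_measurable borel"
    by (auto intro!: borel_measurable_continuous_onI continuous_on_circ_compose assms continuous_intros)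
  have "\<bar>Re (circ t)\<bar> \<le> 1" for t using abs_Re_le_cmod[of "circ t"] by simp
  then have "(\<lambda>t. 2 * Re (circ t)) -` (- {-2..2}) = {}"
    by (fastforce simp: abs_le_iff)
  then show ?thesis
    unfolding circle_measure_def by (subst emeasure_distr) auto
qed

section \<open>Bernstein-Szego densities and the stability of their moments\<close>

locale szego_chain =
  fixes d m :: "nat \<Rightarrow> nat" and a b :: "nat \<Rightarrow> complex \<Rightarrow> complex" and r :: "nat \<Rightarrow> real"
  assumes d_0: "d 0 = 1" and a_0: "a 0 = (\<lambda>z. z)" and b_0: "b 0 = (\<lambda>_. 1)"
    and d_Suc: "d (Suc k) = d k + m k"
    and a_Suc: "a (Suc k) = (\<lambda>z. z ^ m k * a k z - r k * b k z)"
    and b_Suc: "b (Suc k) = (\<lambda>z. b k z - r k * (z ^ m k * a k z))"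
    and m_pos: "m k > 0" and m_even: "even (m k)"
    and r_pos: "r k > 0" and r_le: "r k \<le> 1/40"
begin

definition h :: "nat \<Rightarrow> real" where "h k = (\<Prod>i<k. 1 - (r i)\<^sup>2)"

definition dens :: "nat \<Rightarrow> complex \<Rightarrow> real" where "dens k z = h k / (norm (a k z))\<^sup>2"

definition moment :: "nat \<Rightarrow> real poly \<Rightarrow> real" where
  "moment k q = integral {0..1} (\<lambda>t. dens k (circ t) * poly q (2 * Re (circ t)))"

lemma r_abs: "\<bar>r k\<bar> < 1"
  using r_pos[of k] r_le[of k] by auto

lemma r2_less: "(r k)\<^sup>2 < 1"
  using r_abs abs_square_less_1 by blast

lemma h_pos: "h k > 0"
  unfolding h_def using r2_less by (intro prod_pos) simp

lemma h_Suc: "h (Suc k) = h k * (1 - (r k)\<^sup>2)"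
  by (simp add: h_def)

lemma pair: "szego_pair (d k) (a k) (b k)"
proof (induction k)
  case 0
  show ?case unfolding d_0 a_0 b_0 by (rule szego_pair_init)
next
  case (Suc k)
  show ?case unfolding d_Suc a_Suc b_Suc
    by (rule szego_pair_step[OF Suc r_abs m_pos])
qed

lemmas pairD = szego_pairD[OF pair]

text \<open>The purpose of \<open>m_even\<close>: since \<open>2 * n\<close> never equals a
  \<open>d k\<close>, a positive \<open>n\<close> always satisfies the strict inequality
  \<open>d (block n) < 2 * n\<close> under which the lift is monic of degree
  \<open>n\<close>.\<close>

lemma d_odd: "odd (d k)"
  by (induction k) (auto simp: d_0 d_Suc m_even)

lemma d_strict_mono: "strict_mono d"
  by (rule strict_monoI_Suc) (simp add: d_Suc m_pos)

lemma d_ge: "k < d k"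
proof (induction k)
  case (Suc k)
  then show ?case using m_pos[of k] by (simp add: d_Suc)
qed (simp add: d_0)

lemma dens_cont: "continuous_on (sphere 0 1) (dens k)"
  unfolding dens_def by (intro continuous_intros pairD) (use pairD(10) in auto)

lemma dens_pos: "norm z = 1 \<Longrightarrow> dens k z > 0"
  unfolding dens_def using h_pos pairD(10) by simp

lemma poly_cont: "continuous_on S (poly (q :: real poly))"
  by (intro continuous_intros)

lemma dens_poly_integrable: "(\<lambda>t. dens k (circ t) * poly q (2 * Re (circ t))) integrable_on {0..1}"
  by (rule circ_integrable[of "\<lambda>z. dens k z * poly q (2 * Re z)"]) (intro continuous_intros dens_cont)

lemma moment_Suc:
  assumes "degree q < d (Suc k)"
  shows "moment (Suc k) q = moment k q"
proof -
  define g where "g z = 1 / (b k z * b (Suc k) z)" for z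
  have g: "g holomorphic_on cball 0 1"
    unfolding g_def by (intro holomorphic_intros pairD) (use pairD(7) in auto)
  have "((\<lambda>t. 2 * r k * h k * (poly q (2 * Re (circ t)) * Re (circ t ^ d (Suc k) * g (circ t))))
      has_integral 2 * r k * h k * 0) {0..1}"
    using circle_integral_poly[OF g, of q "d (Suc k)"] assms
    by (intro has_integral_mult_right) (simp add: coeff_eq_0)
  moreover have "((\<lambda>t. dens (Suc k) (circ t) * poly q (2 * Re (circ t)) - dens k (circ t) * poly q (2 * Re (circ t)))
      has_integral (moment (Suc k) q - moment k q)) {0..1}"
    unfolding moment_def by (intro has_integral_diff integrable_integral dens_poly_integrable)
  moreover have "dens (Suc k) z * y - dens k z * y = 2 * r k * h k * (y * Re (z ^ d (Suc k) * g z))"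
    if "norm z = 1" for z y
  proof -
    have "dens (Suc k) z - dens k z = h k * ((1 - (r k)\<^sup>2) / (norm (a (Suc k) z))\<^sup>2 - 1 / (norm (a k z))\<^sup>2)"
      by (simp add: dens_def h_Suc algebra_simps)
    also have "\<dots> = h k * (2 * r k * Re (z ^ d (Suc k) * g z))"
      unfolding a_Suc d_Suc g_def b_Suc szego_density_diff[OF pair r_abs m_pos that] ..
    finally have "dens (Suc k) z = dens k z + h k * (2 * r k * Re (z ^ d (Suc k) * g z))"
      by linarith
    then show ?thesis by (simp only: algebra_simps)
  qed
  ultimately have "moment (Suc k) q - moment k q = 2 * r k * h k * 0"
    by (metis (no_types, lifting) has_integral_cong has_integral_unique norm_circ)
  then show ?thesis by simp
qed

lemma moment_eq:
  assumes "degree q < d (Suc k)" "k \<le> l"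
  shows "moment l q = moment k q"
  using assms(2)
proof (induction l rule: dec_induct)
  case (step l)
  have "d (Suc k) \<le> d (Suc l)"
    using step by (intro monoD[OF strict_mono_mono[OF d_strict_mono]]) simp
  then show ?case using step assms(1) by (simp add: moment_Suc)
qed simp

lemma moment_one: "moment k 1 = 1"
proof -
  have "moment k 1 = moment 0 1"
    using d_ge[of 1] by (intro moment_eq) auto
  also have "\<dots> = 1"
    by (simp add: moment_def dens_def h_def a_0)
  finally show ?thesis .
qed

definition \<nu> :: "nat \<Rightarrow> real measure" where "\<nu> k = circle_measure (dens k)"

lemma \<nu>_integral:
  assumes "continuous_on UNIV (\<phi> :: real \<Rightarrow> real)"
  shows "integrable (\<nu> k) \<phi>"
    "(\<integral>x. \<phi> x \<partial>\<nu> k) = integral {0..1} (\<lambda>t. dens k (circ t) * \<phi> (2 * Re (circ t)))"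
  unfolding \<nu>_def using circle_measure_integral[OF dens_cont _ assms] dens_pos less_imp_le by blast+

lemma \<nu>_distribution: "real_distribution (\<nu> k)"
  unfolding \<nu>_def
  by (rule circle_measure_real_distribution[OF dens_cont])
     (use dens_pos moment_one in \<open>auto simp: less_imp_le moment_def\<close>)

lemma \<nu>_outside: "emeasure (\<nu> k) (- {-2..2}) = 0"
  unfolding \<nu>_def by (rule emeasure_circle_measure_outside[OF dens_cont])

section \<open>Orthogonal polynomials on the interval\<close>

lemma monic_lift:
  assumes "2 * n > d k"
  shows "\<exists>P::real poly. degree P = n \<and> coeff P n = 1 \<and>
    (\<forall>z. norm z = 1 \<longrightarrow> poly P (2 * Re z) = 2 * Re (z powi (int n - int (d k)) * a k z))"
proof -
  obtain P :: "real poly" where P: "int (degree P) \<le> max (int n) (int (d k) - int n) \<and>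
        (2 * int n > int (d k) \<longrightarrow> coeff P (nat (int n)) = 1) \<and>
        (\<forall>z. norm z = 1 \<longrightarrow> poly P (2 * Re z) = 2 * Re (z powi (int n - int (d k)) * a k z))"
    using pair[of k] unfolding szego_pair_def by blast
  then have "degree P \<le> n" "coeff P n = 1" using assms by auto
  then have "degree P = n" using le_degree[of P n] by auto
  with P \<open>coeff P n = 1\<close> show ?thesis by blast
qed

text \<open>On the circle \<open>P\<close> is \<open>2 * (norm (a k z))\<^sup>2\<close> times the
  real part of \<open>z ^ n / b k z\<close>, so it cancels the denominator of the density. As
  \<open>1 / b k\<close> is holomorphic on the closed disc with value 1 at 0, only the coefficient
  of \<open>q\<close> at \<open>n\<close> is left: lower degrees give orthogonality, degree
  \<open>n\<close> gives the norm.\<close>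

lemma moment_mult:
  assumes P: "\<And>z. norm z = 1 \<Longrightarrow> poly P (2 * Re z) = 2 * Re (z powi (int n - int (d k)) * a k z)"
    and q: "degree q \<le> n"
  shows "moment k (q * P) = 2 * h k * coeff q n"
proof -
  define g where "g z = 1 / b k z" for z
  have g: "g holomorphic_on cball 0 1"
    unfolding g_def by (intro holomorphic_intros pairD) (use pairD(7) in auto)
  have "((\<lambda>t. 2 * h k * (poly q (2 * Re (circ t)) * Re (circ t ^ n * g (circ t))))
      has_integral 2 * h k * (coeff q n * Re (g 0))) {0..1}"
    by (intro has_integral_mult_right circle_integral_poly g q)
  moreover have "2 * h k * (poly q (2 * Re z) * Re (z ^ n * g z)) = dens k z * poly (q * P) (2 * Re z)"
    if z: "norm z = 1" for z
  proof -
    have nz: "z \<noteq> 0" "a k z \<noteq> 0" "b k z \<noteq> 0" using z pairD(7,10) by auto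
    have "z powi (int n - int (d k)) * a k z = z ^ n * (cnj z ^ d k * a k z)"
      using nz cnj_unit_mult(3)[OF z] by (simp add: power_int_diff field_simps)
    also have "cnj z ^ d k * a k z = cnj (b k z)"
      unfolding pairD(8)[OF z] by simp
    also have "cnj (b k z) = g z * of_real ((norm (b k z))\<^sup>2)"
      unfolding g_def complex_norm_square using nz by simp
    also have "norm (b k z) = norm (a k z)" by (rule pairD(9)[OF z])
    finally have "z powi (int n - int (d k)) * a k z = ((norm (a k z))\<^sup>2) *\<^sub>R (z ^ n * g z)"
      by (simp add: scaleR_conv_of_real mult_ac)
    then have "poly P (2 * Re z) = 2 * ((norm (a k z))\<^sup>2 * Re (z ^ n * g z))"
      unfolding P[OF z] by (simp only: scaleR_complex.sel)
    then show ?thesis using nz by (simp add: dens_def)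
  qed
  ultimately have "((\<lambda>t. dens k (circ t) * poly (q * P) (2 * Re (circ t)))
      has_integral 2 * h k * (coeff q n * Re (g 0))) {0..1}"
    by (rule has_integral_eq[rotated]) auto
  then show ?thesis
    unfolding moment_def using pairD(3)[of k] by (simp add: integral_unique g_def)
qed

text \<open>Degree \<open>n\<close> on the interval corresponds to degree \<open>2 * n - 1\<close>
  on the circle, and \<open>block n\<close> counts the nonzero coefficients that have entered by
  then. The bound \<open>2 * n < d (Suc (block n))\<close> also means that moments of products of
  two polynomials of degree at most \<open>n\<close> are final at this stage.\<close>

definition block :: "nat \<Rightarrow> nat" where "block n = (LEAST k. 2 * n < d (Suc k))"

lemma block_upper: "2 * n < d (Suc (block n))"
  unfolding block_def
proof (rule LeastI[of _ "2 * n"])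
  show "2 * n < d (Suc (2 * n))" using d_ge[of "Suc (2 * n)"] by simp
qed

lemma block_lower:
  assumes "n > 0"
  shows "d (block n) < 2 * n"
proof (cases "block n")
  case (Suc k)
  have "\<not> 2 * n < d (Suc k)"
    using not_less_Least[of k "\<lambda>k. 2 * n < d (Suc k)"] Suc unfolding block_def by simp
  then have "d (block n) \<le> 2 * n" using Suc by simp
  moreover have "d (block n) \<noteq> 2 * n" using d_odd[of "block n"] by (metis even_mult_iff even_numeral)
  ultimately show ?thesis by simp
qed (use assms in \<open>simp add: d_0\<close>)

definition monic :: "nat \<Rightarrow> real poly" where
  "monic n = (SOME P. degree P = n \<and> coeff P n = 1 \<and>
    (\<forall>z. norm z = 1 \<longrightarrow> poly P (2 * Re z) = 2 * Re (z powi (int n - int (d (block n))) * a (block n) z)))"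

lemma monic:
  assumes "n > 0"
  shows "degree (monic n) = n" "coeff (monic n) n = 1"
    "norm z = 1 \<Longrightarrow> poly (monic n) (2 * Re z) = 2 * Re (z powi (int n - int (d (block n))) * a (block n) z)"
  using someI_ex[OF monic_lift[OF block_lower[OF assms]]] unfolding monic_def by blast+

text \<open>At index 0 the lift is the constant 2, so there is no monic lift, and the normalisation
  by \<open>sqrt (2 * h 0)\<close> would give \<open>sqrt 2\<close> instead of 1.\<close>

definition orth_poly :: "nat \<Rightarrow> real poly" where
  "orth_poly n = (if n = 0 then 1 else smult (1 / sqrt (2 * h (block n))) (monic n))"

lemma orth_poly_degree: "degree (orth_poly n) = n" "lead_coeff (orth_poly n) > 0"
proof -
  have "1 / sqrt (2 * h (block n)) > 0" using h_pos by simp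
  then show *: "degree (orth_poly n) = n" using monic(1) by (simp add: orth_poly_def)
  show "lead_coeff (orth_poly n) > 0"
    unfolding * using h_pos monic(2) by (simp add: orth_poly_def)
qed

lemma moment_smult: "moment k (smult c q) = c * moment k q"
  unfolding moment_def poly_smult mult.left_commute[of _ c] by simp

lemma orthonormal_moment:
  assumes "i \<le> n"
  shows "moment (block n) (orth_poly i * orth_poly n) = (if i = n then 1 else 0)"
proof (cases "n = 0")
  case True
  then show ?thesis using assms by (simp add: orth_poly_def moment_one)
next
  case False
  then have n: "n > 0" by simp
  have "moment (block n) (orth_poly i * orth_poly n)
      = 1 / sqrt (2 * h (block n)) * moment (block n) (orth_poly i * monic n)"
    using n by (simp add: orth_poly_def moment_smult)
  also have "moment (block n) (orth_poly i * monic n) = 2 * h (block n) * coeff (orth_poly i) n"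
    using assms orth_poly_degree(1) n by (intro moment_mult monic) auto
  also have "coeff (orth_poly i) n = (if i = n then 1 / sqrt (2 * h (block n)) else 0)"
  proof (cases "i = n")
    case True then show ?thesis using n monic(2) by (simp add: orth_poly_def)
  next
    case False then show ?thesis using assms orth_poly_degree(1)[of i] by (simp add: coeff_eq_0)
  qed
  finally show ?thesis
    using h_pos[of "block n"] by (simp add: real_sqrt_mult_self)
qed

end

section \<open>The limit measure and its singularity\<close>

lemma closed_measure_support: "closed (measure_support M)"
proof -
  have "- measure_support M = \<Union>{U. open U \<and> \<not> emeasure M U > 0}"
    by (auto simp: measure_support_def)
  then show ?thesis unfolding closed_def by auto
qed

lemma measure_support_null:
  fixes M :: "'a::second_countable_topology measure"
  assumes "sets M = sets borel"
  shows "- measure_support M \<in> null_sets M"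
proof -
  obtain F where F: "F \<subseteq> {U. open U \<and> \<not> emeasure M U > 0}" "countable F"
      "\<Union>F = \<Union>{U. open U \<and> \<not> emeasure M U > 0}"
    using Lindelof[of "{U. open U \<and> \<not> emeasure M U > 0}"] by blast
  have "U \<in> null_sets M" if "U \<in> F" for U
    using F(1) that assms by (auto simp: null_sets_def)
  then have "\<Union>F \<in> null_sets M"
    using null_sets_UN'[OF F(2), of id M] by auto
  moreover have "- measure_support M = \<Union>F"
    unfolding F(3) by (auto simp: measure_support_def)
  ultimately show ?thesis by simp
qed

lemma ex_circ:
  assumes "norm z = 1"
  obtains t where "t \<in> {0..1}" "circ t = z"
proof (rule that)
  show "Arg2pi z / (2 * pi) \<in> {0..1}"
    using Arg2pi_ge_0[of z] Arg2pi_lt_2pi[of z] by (auto simp: field_simps)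
  show "circ (Arg2pi z / (2 * pi)) = z"
    using Arg2pi_eq[of z] assms by (simp add: circ_def cis_conv_exp)
qed

section \<open>The weak limit, its orthonormal polynomials and its support\<close>

context szego_chain
begin

definition chain_limit :: "real measure \<Rightarrow> bool" where
  "chain_limit M \<longleftrightarrow> real_distribution M \<and> (AE x in M. x \<in> {-2..2}) \<and>
     (\<forall>k q. degree q < d (Suc k) \<longrightarrow> (\<integral>x. poly q x \<partial>M) = moment k q)"

lemma AE_\<nu>: "AE x in \<nu> k. x \<in> {-2..2}"
proof -
  interpret real_distribution "\<nu> k" by (rule \<nu>_distribution)
  show ?thesis using \<nu>_outside by (intro AE_I[of _ _ "- {-2..2}"]) auto
qed

lemma tight_\<nu>: "tight \<nu>"
  unfolding tight_def
proof (intro conjI allI impI \<nu>_distribution)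
  fix e :: real assume "e > 0"
  have "measure (\<nu> n) {-3<..2} = 1" for n
  proof -
    interpret real_distribution "\<nu> n" by (rule \<nu>_distribution)
    have "AE x in \<nu> n. x \<in> {-3<..2}" using AE_\<nu>[of n] by eventually_elim auto
    then show ?thesis by (subst prob_eq_1) auto
  qed
  then show "\<exists>a b. a < b \<and> (\<forall>n. 1 - e < measure (\<nu> n) {a<..b})"
    using \<open>e > 0\<close> by (intro exI[of _ "-3"] exI[of _ 2]) auto
qed

text \<open>Passing to a subsequence does no harm, because each moment is eventually constant. Weak
  convergence tests bounded continuous functions only, so mass off the interval is detected by
  \<open>out\<close>, and polynomials are clamped to the interval.\<close>

lemma ex_chain_limit: "\<exists>M. chain_limit M"
proof -
  obtain s M where s: "strict_mono (s :: nat \<Rightarrow> nat)" and M: "real_distribution M"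
    and conv: "weak_conv_m (\<nu> \<circ> id \<circ> s) M"
    using tight_imp_convergent_subsubsequence[OF tight_\<nu>, of id] by (auto simp: strict_mono_def)
  interpret M: real_distribution M by (rule M)
  have conv': "weak_conv_m (\<lambda>n. \<nu> (s n)) M" using conv by (simp add: o_def)
  have lim: "(\<lambda>n. \<integral>x. f x \<partial>\<nu> (s n)) \<longlonglongrightarrow> (\<integral>x. f x \<partial>M)"
    if "continuous_on UNIV f" "\<And>x. norm (f x) \<le> B" for f :: "real \<Rightarrow> real" and B
    by (rule weak_conv_imp_integral_bdd_continuous_conv[OF \<nu>_distribution M conv'])
       (use that in \<open>auto simp: continuous_on_eq_continuous_at\<close>)
  define out where "out x = min 1 (max 0 (\<bar>x\<bar> - 2))" for x :: real
  have out_cont: "continuous_on UNIV out" unfolding out_def by (intro continuous_intros)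
  have out_bd: "norm (out x) \<le> 1" for x by (simp add: out_def)
  have [measurable]: "out \<in> borel_measurable borel"
    by (rule borel_measurable_continuous_onI[OF out_cont])
  have "(\<integral>x. out x \<partial>\<nu> k) = 0" for k
  proof (rule integral_eq_zero_AE)
    show "AE x in \<nu> k. out x = 0" using AE_\<nu>[of k] by eventually_elim (auto simp: out_def)
  qed
  then have "(\<integral>x. out x \<partial>M) = 0"
    using lim[OF out_cont out_bd] LIMSEQ_unique[OF _ tendsto_const] by simp
  moreover have "integrable M out"
    by (rule M.integrable_const_bound[of _ 1]) (use out_bd in auto)
  ultimately have "AE x in M. out x = 0"
    by (subst (asm) integral_nonneg_eq_0_iff_AE) (auto simp: out_def)
  then have AE_M: "AE x in M. x \<in> {-2..2}"
    by eventually_elim (auto simp: out_def min_def max_def split: if_splits)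
  have "(\<integral>x. poly q x \<partial>M) = moment k q" if q: "degree q < d (Suc k)" for k q
  proof -
    define \<phi> where "\<phi> x = poly q (max (-2) (min 2 x))" for x
    have \<phi>_cont: "continuous_on UNIV \<phi>" unfolding \<phi>_def by (intro continuous_intros)
    have [measurable]: "\<phi> \<in> borel_measurable borel" "poly q \<in> borel_measurable borel"
      using \<phi>_cont poly_cont by (auto intro: borel_measurable_continuous_onI)
    have "compact (poly q ` {-2..2})" by (intro compact_continuous_image poly_cont) auto
    then have "bounded (poly q ` {-2..2})" by (rule compact_imp_bounded)
    then obtain B where "\<forall>y \<in> poly q ` {-2..2}. norm y \<le> B"
      unfolding bounded_iff ..
    then have B: "norm (\<phi> x) \<le> B" for x unfolding \<phi>_def by simp
    have eq: "\<phi> x = poly q x" if "x \<in> {-2..2}" for x using that by (simp add: \<phi>_def)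
    have "(\<integral>x. \<phi> x \<partial>\<nu> l) = moment k q" if "k \<le> l" for l
    proof -
      interpret l: real_distribution "\<nu> l" by (rule \<nu>_distribution)
      have "AE x in \<nu> l. \<phi> x = poly q x" using AE_\<nu>[of l] by eventually_elim (rule eq)
      then have "(\<integral>x. \<phi> x \<partial>\<nu> l) = (\<integral>x. poly q x \<partial>\<nu> l)" by (intro integral_cong_AE) auto
      also have "\<dots> = moment l q" unfolding moment_def by (rule \<nu>_integral(2)[OF poly_cont])
      also have "\<dots> = moment k q" by (rule moment_eq[OF q that])
      finally show ?thesis .
    qed
    moreover have "eventually (\<lambda>n. k \<le> s n) sequentially"
      using filterlim_subseq[OF s] by (simp add: filterlim_at_top)
    ultimately have "(\<lambda>n. \<integral>x. \<phi> x \<partial>\<nu> (s n)) \<longlonglongrightarrow> moment k q"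
      by (intro tendsto_eventually) (auto elim: eventually_mono)
    then have "(\<integral>x. \<phi> x \<partial>M) = moment k q"
      using lim[OF \<phi>_cont B] LIMSEQ_unique by blast
    moreover have "(\<integral>x. \<phi> x \<partial>M) = (\<integral>x. poly q x \<partial>M)"
      by (intro integral_cong_AE) (use AE_M eq in \<open>auto elim: eventually_mono\<close>)
    ultimately show ?thesis by simp
  qed
  with M AE_M show ?thesis unfolding chain_limit_def by blast
qed

lemma chain_limit_integrable:
  assumes M: "chain_limit M" and f: "continuous_on UNIV (f :: real \<Rightarrow> real)"
  shows "integrable M f"
proof -
  interpret M: real_distribution M using M by (simp add: chain_limit_def)
  have [measurable]: "f \<in> borel_measurable borel" using f by (rule borel_measurable_continuous_onI)
  have "compact (f ` {-2..2})"
    by (intro compact_continuous_image) (auto intro: continuous_on_subset[OF f])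
  then have "bounded (f ` {-2..2})" by (rule compact_imp_bounded)
  then obtain B where "\<forall>y \<in> f ` {-2..2}. norm y \<le> B"
    unfolding bounded_iff ..
  then have B: "norm (f x) \<le> B" if "x \<in> {-2..2}" for x using that by simp
  have "AE x in M. norm (f x) \<le> B"
    using M B unfolding chain_limit_def by (auto elim: eventually_mono)
  then show ?thesis by (rule M.integrable_const_bound) simp
qed

lemma chain_limit_orthonormal:
  assumes M: "chain_limit M"
  shows "orthonormal_polys M orth_poly"
proof -
  have int: "(\<integral>x. poly (orth_poly n) x * poly (orth_poly i) x \<partial>M) = (if i = n then 1 else 0)" if "i \<le> n" for i n
  proof -
    have "degree (orth_poly i * orth_poly n) \<le> 2 * n"
      using degree_mult_le[of "orth_poly i" "orth_poly n"] orth_poly_degree(1) that by simp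
    then have "degree (orth_poly i * orth_poly n) < d (Suc (block n))"
      using block_upper[of n] by linarith
    then have "(\<integral>x. poly (orth_poly i * orth_poly n) x \<partial>M) = moment (block n) (orth_poly i * orth_poly n)"
      using M unfolding chain_limit_def by blast
    then show ?thesis using orthonormal_moment[OF that] by (simp add: mult.commute)
  qed
  have "(\<integral>x. poly (orth_poly n) x * poly (orth_poly i) x \<partial>M) = (if i = n then 1 else 0)" for i n
    using int[of i n] int[of n i] by (cases "i \<le> n") (auto simp: mult.commute)
  then show ?thesis
    unfolding orthonormal_polys_def using orth_poly_degree
    by (auto intro!: chain_limit_integrable[OF M] continuous_intros)
qed

lemma chain_limit_support:
  assumes M: "chain_limit M"
  shows "compact (measure_support M)" "infinite (measure_support M)"
proof -
  interpret M: real_distribution M using M by (simp add: chain_limit_def)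
  have null: "- measure_support M \<in> null_sets M"
    by (rule measure_support_null) simp
  have "AE x in M. x \<notin> - {-2..2}"
    using M unfolding chain_limit_def by (auto elim: eventually_mono)
  then have "emeasure M (- {-2..2}) = 0"
    by (subst (asm) AE_iff_null_sets[symmetric]) (auto simp: null_sets_def)
  then have "measure_support M \<subseteq> {-2..2}"
    unfolding measure_support_def by (auto dest!: spec[of _ "- {-2..2}"])
  then show "compact (measure_support M)"
    using closed_measure_support by (metis bounded_closed_interval bounded_subset compact_eq_bounded_closed)
  show "infinite (measure_support M)"
  proof
    assume fin: "finite (measure_support M)"
    define n where "n = Suc (card (measure_support M))"
    \<comment> \<open>If the support were finite, \<open>q\<close> would vanish almost everywhere;
      but by \<open>moment_mult\<close> its product with the monic orthogonal polynomial of the same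
      degree has the positive integral \<open>2 * h (block n)\<close>. The extra linear factor
      ensures \<open>n > 0\<close>.\<close>
    define q where "q = (\<Prod>s\<in>measure_support M. [:- s, 1:]) * [:0, 1::real:]"
    have q: "degree q = n" "coeff q n = 1"
    proof -
      have "lead_coeff q = 1"
        unfolding q_def lead_coeff_mult lead_coeff_prod by simp
      moreover show "degree q = n"
        unfolding q_def n_def
        by (subst degree_mult_eq) (auto simp: degree_prod_eq_sum_degree fin)
      ultimately show "coeff q n = 1" by simp
    qed
    have n: "n > 0" by (simp add: n_def)
    have "AE x in M. x \<in> measure_support M"
      using AE_not_in[OF null] by simp
    then have "AE x in M. poly (q * monic n) x = 0"
      by eventually_elim (auto simp: q_def poly_prod fin)
    then have "(\<integral>x. poly (q * monic n) x \<partial>M) = 0"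
      by (rule integral_eq_zero_AE)
    moreover have "degree (q * monic n) < d (Suc (block n))"
      using degree_mult_le[of q "monic n"] q(1) monic(1)[OF n] block_upper[of n] by simp
    then have "(\<integral>x. poly (q * monic n) x \<partial>M) = moment (block n) (q * monic n)"
      using M unfolding chain_limit_def by blast
    moreover have "moment (block n) (q * monic n) = 2 * h (block n) * coeff q n"
      using q n by (intro moment_mult monic) auto
    ultimately show False using q(2) h_pos[of "block n"] by simp
  qed
qed

end

section \<open>Singularity through the Hellinger integral\<close>

locale singular_szego_chain = szego_chain +
  assumes hellinger: "sqrt (1 - (r k)\<^sup>2) * integral {0..1} (\<lambda>t. 1 / norm (a (Suc k) (circ t)))
      \<le> (1 - (r k)\<^sup>2 / 16) * integral {0..1} (\<lambda>t. 1 / norm (a k (circ t)))"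
    and product_0: "(\<lambda>k. \<Prod>i<k. 1 - (r i)\<^sup>2 / 16) \<longlonglongrightarrow> 0"
    and approx: "\<exists>q. degree q < d (Suc k) \<and>
      (\<forall>z. norm z = 1 \<longrightarrow> \<bar>norm (a k z) / sqrt (\<Prod>i<k. 1 - (r i)\<^sup>2) - poly q (2 * Re z)\<bar> \<le> 1 / real (Suc k))"
begin

text \<open>This is the inverse square root of \<open>dens k\<close>. The integral of
  \<open>1 / phi k\<close> over the circle is the Hellinger integral, and by \<open>dens_phi\<close>
  it is also the integral of \<open>phi k\<close> against \<open>dens k\<close>.\<close>

definition phi :: "nat \<Rightarrow> complex \<Rightarrow> real" where "phi k z = norm (a k z) / sqrt (h k)"

lemma phi_cont: "continuous_on S (phi k)"
proof -
  have "sqrt (h k) \<noteq> 0" using h_pos[of k] by simp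
  then show ?thesis
    unfolding phi_def
    by (intro continuous_on_divide continuous_on_norm continuous_on_const pairD(11)) simp_all
qed

lemma phi_pos: "norm z = 1 \<Longrightarrow> phi k z > 0"
  unfolding phi_def using h_pos[of k] pairD(10)[where k=k and z=z] by simp

lemma inverse_phi_cont: "continuous_on (sphere 0 1) (\<lambda>z. 1 / phi k z)"
proof (intro continuous_on_divide continuous_on_const phi_cont ballI)
  fix z :: complex assume "z \<in> sphere 0 1"
  then show "phi k z \<noteq> 0" using phi_pos[of z k] by simp
qed

lemma phi_cnj: "phi k (cnj z) = phi k z"
  unfolding phi_def pairD(4)[symmetric] by simp

lemma dens_phi: "norm z = 1 \<Longrightarrow> dens k z * phi k z = 1 / phi k z"
proof -
  assume "norm z = 1"
  then have nz: "norm (a k z) \<noteq> 0" using pairD(10)[where k=k] by simp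
  obtain s where s: "sqrt (h k) = s" "s > 0" "h k = s * s"
    using h_pos[of k] by (metis real_sqrt_gt_0_iff real_sqrt_mult_self abs_of_pos)
  then show ?thesis
    using nz unfolding dens_def phi_def s by (simp add: power2_eq_square)
qed

lemma hellinger_tendsto: "(\<lambda>k. integral {0..1} (\<lambda>t. 1 / phi k (circ t))) \<longlonglongrightarrow> 0"
proof -
  define I where "I k = integral {0..1} (\<lambda>t. 1 / norm (a k (circ t)))" for k
  have int: "integral {0..1} (\<lambda>t. 1 / phi k (circ t)) = sqrt (h k) * I k" for k
    unfolding phi_def I_def by (subst integral_mult_right[symmetric]) simp
  have "(\<lambda>t. 1 / norm (a k (circ t))) integrable_on {0..1}" for k
  proof (intro circ_integrable[of "\<lambda>z. 1 / norm (a k z)"] continuous_on_divide continuous_on_const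
      continuous_on_norm pairD(11) ballI)
    show "norm (a k z) \<noteq> 0" if "z \<in> sphere 0 1" for z
      using pairD(10)[where k=k] that by simp
  qed
  then have I: "I k \<ge> 0" for k unfolding I_def by (rule integral_nonneg) simp
  have "sqrt (h k) * I k \<le> (\<Prod>i<k. 1 - (r i)\<^sup>2 / 16)" for k
  proof (induction k)
    case 0 show ?case by (simp add: h_def I_def a_0)
  next
    case (Suc k)
    have "sqrt (h (Suc k)) * I (Suc k) = sqrt (h k) * (sqrt (1 - (r k)\<^sup>2) * I (Suc k))"
      by (simp add: h_Suc real_sqrt_mult)
    also have "\<dots> \<le> sqrt (h k) * ((1 - (r k)\<^sup>2 / 16) * I k)"
      using hellinger[of k] h_pos[of k] unfolding I_def by (intro mult_left_mono) auto
    also have "\<dots> = (1 - (r k)\<^sup>2 / 16) * (sqrt (h k) * I k)" by simp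
    also have "\<dots> \<le> (1 - (r k)\<^sup>2 / 16) * (\<Prod>i<k. 1 - (r i)\<^sup>2 / 16)"
      using Suc r2_less[of k] by (intro mult_left_mono) auto
    finally show ?case by (simp add: mult.commute)
  qed
  then have "\<forall>\<^sub>F k in sequentially. sqrt (h k) * I k \<le> (\<Prod>i<k. 1 - (r i)\<^sup>2 / 16)" by simp
  moreover have "\<forall>\<^sub>F k in sequentially. 0 \<le> sqrt (h k) * I k"
    using I h_pos by (simp add: less_imp_le)
  ultimately show ?thesis
    unfolding int by (intro tendsto_sandwich[OF _ _ tendsto_const product_0])
qed

lemma phi_zeta_cont: "continuous_on UNIV (\<lambda>x. phi k (zeta x))"
  by (rule continuous_on_compose2[OF phi_cont continuous_on_zeta]) auto

text \<open>\<open>phi k\<close> need not be a polynomial, so its integral against \<open>M\<close>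
  is not directly a moment. The polynomial supplied by \<open>approx\<close> has degree below
  \<open>d (Suc k)\<close>, hence the same integral against \<open>M\<close> and against
  \<open>dens k\<close>; passing to it and back costs \<open>1 / Suc k\<close> each time.\<close>

lemma phi_tendsto_L1:
  assumes M: "chain_limit M"
  shows "(\<lambda>k. \<integral>x. norm (phi k (zeta x)) \<partial>M) \<longlonglongrightarrow> 0"
proof -
  interpret M: real_distribution M using M by (simp add: chain_limit_def)
  have bound: "(\<integral>x. norm (phi k (zeta x)) \<partial>M) \<le> integral {0..1} (\<lambda>t. 1 / phi k (circ t)) + 2 / real (Suc k)" for k
  proof -
    obtain q where q: "degree q < d (Suc k)"
      "\<And>z. norm z = 1 \<Longrightarrow> \<bar>phi k z - poly q (2 * Re z)\<bar> \<le> 1 / real (Suc k)"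
      using approx[of k] unfolding phi_def h_def by blast
    have i: "integrable M (poly q)" "integrable M (\<lambda>x. phi k (zeta x))"
      using M phi_zeta_cont poly_cont chain_limit_integrable by blast+
    have "AE x in M. norm (phi k (zeta x)) \<le> poly q x + 1 / real (Suc k)"
    proof -
      have "AE x in M. x \<in> {-2..2}" using M by (simp add: chain_limit_def)
      then show ?thesis
      proof eventually_elim
        case (elim x)
        then show ?case
          using q(2)[OF norm_zeta[OF elim]] phi_pos[OF norm_zeta[OF elim], of k] by simp
      qed
    qed
    then have "(\<integral>x. norm (phi k (zeta x)) \<partial>M) \<le> (\<integral>x. poly q x + 1 / real (Suc k) \<partial>M)"
      using i by (intro integral_mono_AE) auto
    also have "\<dots> = moment k q + 1 / real (Suc k)"
      using i M q(1) M.prob_space unfolding chain_limit_def by simp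
    also have "moment k q \<le> integral {0..1} (\<lambda>t. 1 / phi k (circ t)) + 1 / real (Suc k)"
    proof -
      have "integral {0..1} (\<lambda>t. dens k (circ t)) = 1" using moment_one[of k] by (simp add: moment_def)
      then have d1: "((\<lambda>t. dens k (circ t)) has_integral 1) {0..1}"
        using integrable_integral[OF circ_integrable[OF dens_cont, of k]] by simp
      have pi: "((\<lambda>t. 1 / phi k (circ t)) has_integral integral {0..1} (\<lambda>t. 1 / phi k (circ t))) {0..1}"
        by (rule integrable_integral, rule circ_integrable[OF inverse_phi_cont])
      have "((\<lambda>t. 1 / phi k (circ t) + dens k (circ t) * (1 / real (Suc k))) has_integral
          (integral {0..1} (\<lambda>t. 1 / phi k (circ t)) + 1 * (1 / real (Suc k)))) {0..1}"
        by (intro has_integral_add pi has_integral_mult_left d1)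
      with integrable_integral[OF dens_poly_integrable[of k q]]
      have "moment k q \<le> integral {0..1} (\<lambda>t. 1 / phi k (circ t)) + 1 * (1 / real (Suc k))"
        unfolding moment_def
      proof (rule has_integral_le)
        fix t :: real
        define z where "z = circ t"
        have z: "norm z = 1" by (simp add: z_def)
        have "dens k z * poly q (2 * Re z) \<le> dens k z * (phi k z + 1 / real (Suc k))"
          using q(2)[OF z] less_imp_le[OF dens_pos[OF z]] by (intro mult_left_mono) auto
        then show "dens k (circ t) * poly q (2 * Re (circ t)) \<le> 1 / phi k (circ t) + dens k (circ t) * (1 / real (Suc k))"
          using dens_phi[OF z] by (simp add: z_def distrib_left)
      qed
      then show ?thesis by simp
    qed
    finally show ?thesis by simp
  qed
  have "(\<lambda>k. integral {0..1} (\<lambda>t. 1 / phi k (circ t)) + 2 / real (Suc k)) \<longlonglongrightarrow> 0 + 0"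
    by (intro tendsto_add hellinger_tendsto) (rule LIMSEQ_Suc[OF lim_const_over_n])
  then have lim: "(\<lambda>k. integral {0..1} (\<lambda>t. 1 / phi k (circ t)) + 2 / real (Suc k)) \<longlonglongrightarrow> 0"
    by simp
  show ?thesis
    by (rule Lim_null_comparison[OF _ lim]) (simp add: bound[simplified])
qed

lemma chain_limit_singular:
  assumes M: "chain_limit M"
  shows "mutually_singular M lborel"
proof -
  interpret M: real_distribution M using M by (simp add: chain_limit_def)
  obtain s :: "nat \<Rightarrow> nat" where s: "strict_mono s" "AE x in M. (\<lambda>n. phi (s n) (zeta x)) \<longlonglongrightarrow> 0"
    using tendsto_L1_AE_subseq[OF chain_limit_integrable[OF M phi_zeta_cont] phi_tendsto_L1[OF M]] by blast
  define u where "u n t = indicator {0..1} t *\<^sub>R (1 / phi (s n) (circ t))" for n t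
  have pc: "continuous_on {0..1} (\<lambda>t. 1 / phi k (circ t))" for k
    by (rule continuous_on_circ_compose[OF inverse_phi_cont])
  have si: "set_integrable lborel {0..1} (\<lambda>t. 1 / phi k (circ t))" for k
    by (rule borel_integrable_atLeastAtMost'[OF pc])
  have ui: "integrable lborel (u n)" for n
    using si unfolding set_integrable_def u_def by simp
  have "norm (u n t) = u n t" for n t
    using phi_pos[of "circ t" "s n"] by (auto simp: u_def indicator_def)
  then have "(\<integral>t. norm (u n t) \<partial>lborel) = (\<integral>t. u n t \<partial>lborel)" for n by simp
  then have "(\<integral>t. norm (u n t) \<partial>lborel) = (LINT t:{0..1}|lborel. 1 / phi (s n) (circ t))" for n
    unfolding set_lebesgue_integral_def u_def by simp
  then have "(\<lambda>n. \<integral>t. norm (u n t) \<partial>lborel) \<longlonglongrightarrow> 0"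
    unfolding set_borel_integral_eq_integral(2)[OF si]
    using LIMSEQ_subseq_LIMSEQ[OF hellinger_tendsto s(1)] by (simp add: o_def)
  then obtain s' :: "nat \<Rightarrow> nat" where s': "strict_mono s'" "AE t in lborel. (\<lambda>n. u (s' n) t) \<longlonglongrightarrow> 0"
    using tendsto_L1_AE_subseq[of lborel u, OF ui] by blast
  \<comment> \<open>Along this common subsequence \<open>phi\<close> tends to 0 almost everywhere
    for \<open>M\<close>, while \<open>1 / phi\<close> tends to 0 for almost every parameter
    \<open>t\<close>. Both cannot happen at one point, so \<open>A\<close> carries \<open>M\<close>,
    and every point of \<open>A\<close> comes from a parameter in a null set.\<close>
  define A where "A = {x \<in> {-2..2}. (\<lambda>n. phi (s (s' n)) (zeta x)) \<longlonglongrightarrow> 0}"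
  have [measurable]: "(\<lambda>x. phi k (zeta x)) \<in> borel_measurable borel" for k
    by (rule borel_measurable_continuous_onI[OF phi_zeta_cont])
  have A: "A \<in> sets borel" unfolding A_def by measurable
  have "AE x in M. x \<in> A"
  proof -
    have "AE x in M. x \<in> {-2..2}" using M by (simp add: chain_limit_def)
    with s(2) show ?thesis
    proof eventually_elim
      case (elim x)
      then show ?case using LIMSEQ_subseq_LIMSEQ[OF elim(1) s'(1)] by (simp add: A_def o_def)
    qed
  qed
  then have 1: "emeasure M (space M - A) = 0"
    using A by (subst (asm) AE_iff_measurable[of "space M - A"]) auto
  obtain N where N: "{t. \<not> (\<lambda>n. u (s' n) t) \<longlonglongrightarrow> 0} \<subseteq> N" "N \<in> null_sets lborel"
    using s'(2) by (auto elim!: AE_E simp: null_sets_def)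
  have "negligible N"
    using N(2) by (simp add: negligible_iff_null_sets null_sets_completionI)
  then have "negligible ((\<lambda>t. 2 * Re (circ t)) ` N)"
  proof (rule negligible_differentiable_image_negligible[OF order_refl])
    show "(\<lambda>t. 2 * Re (circ t)) differentiable_on N"
      unfolding differentiable_on_def real_differentiable_def circ_def cis.sel
    proof
      fix t
      have "((\<lambda>t. 2 * cos (2 * pi * t)) has_real_derivative - (4 * pi * sin (2 * pi * t))) (at t within N)"
        by (auto intro!: derivative_eq_intros)
      then show "\<exists>D. ((\<lambda>t. 2 * cos (2 * pi * t)) has_real_derivative D) (at t within N)" ..
    qed
  qed
  moreover have "A \<subseteq> (\<lambda>t. 2 * Re (circ t)) ` N"
  proof
    fix x assume x: "x \<in> A"
    then obtain t where t: "t \<in> {0..1}" "circ t = zeta x"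
      using ex_circ norm_zeta unfolding A_def by blast
    have "\<not> (\<lambda>n. u (s' n) t) \<longlonglongrightarrow> 0"
    proof
      assume "(\<lambda>n. u (s' n) t) \<longlonglongrightarrow> 0"
      moreover have "(\<lambda>n. phi (s (s' n)) (zeta x)) \<longlonglongrightarrow> 0" using x by (simp add: A_def)
      ultimately have "(\<lambda>n. u (s' n) t * phi (s (s' n)) (zeta x)) \<longlonglongrightarrow> 0 * 0"
        by (rule tendsto_mult)
      moreover have "u (s' n) t * phi (s (s' n)) (zeta x) = 1" for n
        using t phi_pos[OF norm_circ, of "s (s' n)" t] by (simp add: u_def)
      ultimately show False by (simp add: LIMSEQ_const_iff)
    qed
    then have "t \<in> N" using N(1) by blast
    moreover have "2 * Re (circ t) = x" using t by simp
    ultimately show "x \<in> (\<lambda>t. 2 * Re (circ t)) ` N" by blast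
  qed
  ultimately have "negligible A" by (rule negligible_subset)
  then have "emeasure lborel A = 0"
    using A by (auto simp: negligible_iff_null_sets null_sets_def)
  with 1 A show ?thesis
    unfolding mutually_singular_def by (intro conjI bexI[of _ A]) auto
qed

end

section \<open>Sine kernel asymptotics of oscillating sums\<close>

lemma norm_cis_diff_le: "norm (cis x - cis y) \<le> \<bar>x - y\<bar>"
proof -
  have "cis x - cis y = cis y * (cis (x - y) - 1)"
    by (simp add: algebra_simps cis_mult)
  then have "norm (cis x - cis y) = norm (exp (\<i> * of_real (x - y)) - 1)"
    by (simp add: norm_mult cis_conv_exp)
  also have "\<dots> = 2 * \<bar>sin ((x - y) / 2)\<bar>" by (rule dist_exp_i_1)
  also have "\<dots> \<le> 2 * \<bar>(x - y) / 2\<bar>" by (intro mult_left_mono abs_sin_x_le_abs_x) auto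
  finally show ?thesis by simp
qed

lemma abs_cos_diff_le: "\<bar>cos x - cos y\<bar> \<le> \<bar>x - y :: real\<bar>"
  using abs_Re_le_cmod[of "cis x - cis y"] norm_cis_diff_le[of x y] by simp

text \<open>A Riemann sum estimate: \<open>cos (real j * t)\<close> is compared with its mean over
  the interval from \<open>j\<close> to \<open>j + 1\<close>, a difference quotient of the sine that
  telescopes.\<close>

lemma sum_cos_sinc:
  "\<bar>(\<Sum>j<n. cos (real j * t)) - real n * sinc (real n * t)\<bar> \<le> real n * \<bar>t\<bar>"
proof (cases "t = 0 \<or> n = 0")
  case False
  have summand: "\<bar>cos (real j * t) - (sin (real (Suc j) * t) - sin (real j * t)) / t\<bar> \<le> \<bar>t\<bar>" for j
  proof -
    have "\<exists>s>real j. s < real (Suc j) \<and>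
        sin (real (Suc j) * t) - sin (real j * t) = (real (Suc j) - real j) * (cos (s * t) * t)"
      by (rule MVT2) (auto intro!: derivative_eq_intros)
    then obtain s where s: "real j < s" "s < real (Suc j)"
        "sin (real (Suc j) * t) - sin (real j * t) = cos (s * t) * t" by auto
    have "\<bar>cos (real j * t) - cos (s * t)\<bar> \<le> \<bar>real j - s\<bar> * \<bar>t\<bar>"
      using abs_cos_diff_le[of "real j * t" "s * t"] by (simp add: left_diff_distrib[symmetric] abs_mult)
    also have "\<dots> \<le> 1 * \<bar>t\<bar>" using s by (intro mult_right_mono) auto
    finally show ?thesis unfolding s(3) using False by simp
  qed
  have "(\<Sum>j<n. (sin (real (Suc j) * t) - sin (real j * t)) / t) = sin (real n * t) / t"
    unfolding sum_divide_distrib[symmetric] sum_lessThan_telescope[of "\<lambda>j. sin (real j * t)"] by simp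
  also have "\<dots> = real n * sinc (real n * t)" using False by simp
  finally have "(\<Sum>j<n. cos (real j * t)) - real n * sinc (real n * t)
      = (\<Sum>j<n. cos (real j * t) - (sin (real (Suc j) * t) - sin (real j * t)) / t)"
    by (simp add: sum_subtractf)
  also have "\<bar>\<dots>\<bar> \<le> (\<Sum>j<n. \<bar>t\<bar>)"
    by (rule order.trans[OF sum_abs sum_mono[OF summand]])
  finally show ?thesis by simp
qed auto

lemma sum_power_bound:
  assumes "norm (z :: complex) = 1" "z \<noteq> 1"
  shows "norm (\<Sum>j<n. z ^ j) \<le> 2 / norm (1 - z)"
proof -
  have "(\<Sum>j<n. z ^ j) = (1 - z ^ n) / (1 - z)"
    using sum_gp_strict[of z n] assms(2) by simp
  moreover have "norm (1 - z ^ n) \<le> 2"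
    using norm_triangle_ineq4[of 1 "z ^ n"] by (simp add: norm_power assms)
  ultimately show ?thesis
    using assms(2) by (simp add: norm_divide divide_right_mono)
qed

text \<open>Each product is half of \<open>Re (X * cnj Y) + Re (X * Y)\<close>. In the first part
  the phase of \<open>A n\<close> cancels and a Riemann sum for \<open>sinc\<close> remains. The
  second is a geometric sum whose ratio tends to \<open>cis (2 * \<theta>)\<close>; as
  \<open>\<theta>\<close> lies strictly between 0 and \<open>pi\<close>, the ratio stays away from 1
  and division by \<open>n\<close> kills the sum.\<close>

lemma oscillation_product_limit:
  fixes A :: "nat \<Rightarrow> complex"
  assumes A: "\<And>n. norm (A n) = 1"
    and t: "t \<longlonglongrightarrow> \<theta>" "t' \<longlonglongrightarrow> \<theta>" and \<theta>: "0 < \<theta>" "\<theta> < pi"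
    and diff: "(\<lambda>n. real n * (t n - t' n)) \<longlonglongrightarrow> \<phi>"
  shows "(\<lambda>n. (\<Sum>j<n. Re (cis (t n) ^ j * A n) * Re (cis (t' n) ^ j * A n)) / real n)
           \<longlonglongrightarrow> sinc \<phi> / 2"
proof -
  define S where "S n = (\<Sum>j<n. cos (real j * (t n - t' n))) / real n" for n
  define w where "w n = cis (t n + t' n)" for n
  define R where "R n = Re ((A n)\<^sup>2 * (\<Sum>j<n. w n ^ j)) / real n" for n
  have eq: "(\<Sum>j<n. Re (cis (t n) ^ j * A n) * Re (cis (t' n) ^ j * A n)) / real n = S n / 2 + R n / 2" for n
  proof -
    have summand: "Re (cis (t n) ^ j * A n) * Re (cis (t' n) ^ j * A n)
        = cos (real j * (t n - t' n)) / 2 + Re ((A n)\<^sup>2 * w n ^ j) / 2" for j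
    proof -
      define X Y where "X = cis (t n) ^ j * A n" and "Y = cis (t' n) ^ j * A n"
      have "cis (t n) ^ j * cnj (cis (t' n)) ^ j = cis (real j * (t n - t' n))"
        unfolding power_mult_distrib[symmetric] cis_cnj cis_mult by (simp add: Complex.DeMoivre)
      moreover have "X * cnj Y = (cis (t n) ^ j * cnj (cis (t' n)) ^ j) * (A n * cnj (A n))"
        unfolding X_def Y_def by simp
      ultimately have "X * cnj Y = cis (real j * (t n - t' n)) * (A n * cnj (A n))"
        by metis
      then have 1: "X * cnj Y = cis (real j * (t n - t' n))"
        using cnj_unit_mult(1)[OF A[of n]] by simp
      have 2: "X * Y = (A n)\<^sup>2 * w n ^ j"
        unfolding X_def Y_def w_def cis_mult[symmetric] power_mult_distrib power2_eq_square by simp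
      have "Re X * Re Y = Re (X * cnj Y) / 2 + Re (X * Y) / 2"
        by (simp add: field_simps)
      then show ?thesis unfolding 1 2 unfolding X_def Y_def by simp
    qed
    have "(\<Sum>j<n. Re ((A n)\<^sup>2 * w n ^ j)) = Re ((A n)\<^sup>2 * (\<Sum>j<n. w n ^ j))"
      unfolding sum_distrib_left Re_sum ..
    then show ?thesis
      unfolding summand S_def R_def sum.distrib sum_divide_distrib[symmetric] by (simp add: add_divide_distrib)
  qed
  have "S \<longlonglongrightarrow> sinc \<phi>"
  proof (rule Lim_transform2)
    show "(\<lambda>n. sinc (real n * (t n - t' n))) \<longlonglongrightarrow> sinc \<phi>"
      by (rule isCont_tendsto_compose[OF isCont_sinc diff])
    have "(\<lambda>n. t n - t' n) \<longlonglongrightarrow> 0"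
      using tendsto_diff[OF t] by simp
    then have lim0: "(\<lambda>n. \<bar>t n - t' n\<bar>) \<longlonglongrightarrow> 0"
      by (rule tendsto_rabs_zero)
    show "(\<lambda>n. sinc (real n * (t n - t' n)) - S n) \<longlonglongrightarrow> 0"
    proof (rule Lim_null_comparison[OF _ lim0])
      show "\<forall>\<^sub>F n in sequentially. norm (sinc (real n * (t n - t' n)) - S n) \<le> \<bar>t n - t' n\<bar>"
        using eventually_gt_at_top[of "0::nat"]
      proof eventually_elim
        case (elim n)
        define X where "X = sinc (real n * (t n - t' n))"
        have "\<bar>real n * S n - real n * X\<bar> \<le> real n * \<bar>t n - t' n\<bar>"
          using sum_cos_sinc[where n=n and t="t n - t' n"] elim unfolding S_def X_def by simp
        then have "real n * \<bar>X - S n\<bar> \<le> real n * \<bar>t n - t' n\<bar>"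
          by (simp add: right_diff_distrib[symmetric] abs_mult abs_minus_commute)
        then show ?case using elim by (simp add: X_def)
      qed
    qed
  qed
  moreover have "R \<longlonglongrightarrow> 0"
  proof -
    have "w \<longlonglongrightarrow> cis (\<theta> + \<theta>)" unfolding w_def by (intro tendsto_intros t)
    then have lim: "(\<lambda>n. norm (1 - w n)) \<longlonglongrightarrow> norm (1 - cis (\<theta> + \<theta>))" by (intro tendsto_intros)
    have "sin \<theta> > 0" using \<theta> by (rule sin_gt_zero)
    then have "cos (2 * \<theta>) < 1" by (simp add: cos_double_sin)
    then have ne: "norm (1 - cis (\<theta> + \<theta>)) > 0" by (auto simp: complex_eq_iff)
    then have lim2: "(\<lambda>n. 2 / norm (1 - w n) / real n) \<longlonglongrightarrow> 0"
      by (intro tendsto_divide_0[OF tendsto_divide[OF tendsto_const lim]]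
            filterlim_at_top_imp_at_infinity filterlim_real_sequentially) auto
    show ?thesis
    proof (rule Lim_null_comparison[OF _ lim2])
      have "\<forall>\<^sub>F n in sequentially. norm (1 - w n) > 0"
        using lim ne by (rule order_tendstoD)
      then show "\<forall>\<^sub>F n in sequentially. norm (R n) \<le> 2 / norm (1 - w n) / real n"
      proof eventually_elim
        case (elim n)
        have "\<bar>Re ((A n)\<^sup>2 * (\<Sum>j<n. w n ^ j))\<bar> \<le> norm ((A n)\<^sup>2 * (\<Sum>j<n. w n ^ j))"
          by (rule abs_Re_le_cmod)
        also have "\<dots> = norm (\<Sum>j<n. w n ^ j)" by (simp add: norm_mult norm_power A)
        also have "\<dots> \<le> 2 / norm (1 - w n)"
          using elim by (intro sum_power_bound) (auto simp: w_def)
        finally have "\<bar>Re ((A n)\<^sup>2 * (\<Sum>j<n. w n ^ j))\<bar> / real n \<le> 2 / norm (1 - w n) / real n"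
          by (rule divide_right_mono) simp
        then show ?case unfolding R_def real_norm_def abs_divide abs_of_nat .
      qed
    qed
  qed
  ultimately have "(\<lambda>n. S n / 2 + R n / 2) \<longlonglongrightarrow> sinc \<phi> / 2 + 0 / 2"
    by (intro tendsto_intros) auto
  then show ?thesis unfolding eq by simp
qed

lemma sum_product_perturbation:
  fixes u v U V :: "nat \<Rightarrow> real"
  assumes u: "(\<Sum>j<n. (u j - U j)\<^sup>2) \<le> \<delta> * c" and v: "(\<Sum>j<n. (v j - V j)\<^sup>2) \<le> \<delta>' * c"
    and U: "(\<Sum>j<n. (U j)\<^sup>2) \<le> c" and V: "(\<Sum>j<n. (V j)\<^sup>2) \<le> c"
    and nn: "0 \<le> \<delta>" "0 \<le> \<delta>'" "0 \<le> c"
  shows "\<bar>(\<Sum>j<n. u j * v j) - (\<Sum>j<n. U j * V j)\<bar> \<le> (sqrt \<delta> * sqrt \<delta>' + sqrt \<delta> + sqrt \<delta>') * c"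
proof -
  have CS: "\<bar>\<Sum>j<n. f j * g j\<bar> \<le> sqrt x * sqrt y * c"
    if "(\<Sum>j<n. (f j)\<^sup>2) \<le> x * c" "(\<Sum>j<n. (g j)\<^sup>2) \<le> y * c" "0 \<le> x" "0 \<le> y" for f g :: "nat \<Rightarrow> real" and x y
  proof -
    have "(\<Sum>j<n. f j * g j)\<^sup>2 \<le> (\<Sum>j<n. (f j)\<^sup>2) * (\<Sum>j<n. (g j)\<^sup>2)"
      by (rule Cauchy_Schwarz_ineq_sum)
    also have "\<dots> \<le> (x * c) * (y * c)"
      using that nn by (intro mult_mono) (auto intro: sum_nonneg)
    also have "\<dots> = (sqrt x * sqrt y * c)\<^sup>2"
      using that by (simp add: power_mult_distrib) (simp add: power2_eq_square)
    finally have "\<bar>\<Sum>j<n. f j * g j\<bar>\<^sup>2 \<le> (sqrt x * sqrt y * c)\<^sup>2" by simp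
    then show ?thesis
      by (rule power2_le_imp_le) (simp add: that nn)
  qed
  have "(\<Sum>j<n. u j * v j) - (\<Sum>j<n. U j * V j)
      = (\<Sum>j<n. (u j - U j) * (v j - V j)) + (\<Sum>j<n. (u j - U j) * V j) + (\<Sum>j<n. U j * (v j - V j))"
    unfolding sum_subtractf[symmetric] sum.distrib[symmetric]
    by (rule sum.cong) (simp_all add: algebra_simps)
  moreover have "\<bar>\<Sum>j<n. (u j - U j) * (v j - V j)\<bar> \<le> sqrt \<delta> * sqrt \<delta>' * c"
    by (rule CS[OF u v nn(1,2)])
  moreover have "\<bar>\<Sum>j<n. (u j - U j) * V j\<bar> \<le> sqrt \<delta> * sqrt 1 * c"
    using V by (intro CS[OF u _ nn(1)]) auto
  moreover have "\<bar>\<Sum>j<n. U j * (v j - V j)\<bar> \<le> sqrt 1 * sqrt \<delta>' * c"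
    using U by (intro CS[OF _ v _ nn(2)]) auto
  ultimately show ?thesis
    unfolding distrib_right real_sqrt_one mult_1 mult_1_right by linarith
qed

text \<open>Errors are measured in mean square relative to \<open>A n\<close>, which tolerates a
  small proportion of bad indices. No uniform bound on \<open>A n\<close> is assumed, because the
  amplitudes to which this is applied are only bounded exponentially in the block index.\<close>

lemma perturbed_product_limit:
  fixes A :: "nat \<Rightarrow> complex" and u v :: "nat \<Rightarrow> nat \<Rightarrow> real"
  assumes A: "\<And>n. A n \<noteq> 0"
    and t: "t \<longlonglongrightarrow> \<theta>" "t' \<longlonglongrightarrow> \<theta>" and \<theta>: "0 < \<theta>" "\<theta> < pi"
    and diff: "(\<lambda>n. real n * (t n - t' n)) \<longlonglongrightarrow> \<phi>"
    and u: "\<forall>\<^sub>F n in sequentially. (\<Sum>j<n. (u n j - Re (cis (t n) ^ j * A n))\<^sup>2) \<le> \<delta> n * (real n * (norm (A n))\<^sup>2)"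
    and v: "\<forall>\<^sub>F n in sequentially. (\<Sum>j<n. (v n j - Re (cis (t' n) ^ j * A n))\<^sup>2) \<le> \<delta>' n * (real n * (norm (A n))\<^sup>2)"
    and \<delta>: "\<delta> \<longlonglongrightarrow> 0" "\<delta>' \<longlonglongrightarrow> 0" "\<And>n. \<delta> n \<ge> 0" "\<And>n. \<delta>' n \<ge> 0"
  shows "(\<lambda>n. (\<Sum>j<n. u n j * v n j) / (real n * (norm (A n))\<^sup>2)) \<longlonglongrightarrow> sinc \<phi> / 2"
proof (rule Lim_transform2)
  define B where "B n = sgn (A n)" for n
  have B: "norm (B n) = 1" and AB: "A n = norm (A n) *\<^sub>R B n" for n
    using A[of n] by (auto simp: B_def norm_sgn sgn_div_norm)
  define P where "P n = (\<Sum>j<n. Re (cis (t n) ^ j * A n) * Re (cis (t' n) ^ j * A n))" for n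
  have eq: "(\<Sum>j<n. Re (cis (t n) ^ j * B n) * Re (cis (t' n) ^ j * B n)) / real n
      = P n / (real n * (norm (A n))\<^sup>2)" for n
  proof -
    have "Re (x * A n) = norm (A n) * Re (x * B n)" for x
      by (subst AB) (simp only: mult_scaleR_right scaleR_complex.sel)
    then have "Re (x * A n) * Re (y * A n) = (norm (A n))\<^sup>2 * (Re (x * B n) * Re (y * B n))" for x y
      by (simp only: power2_eq_square mult.assoc mult.left_commute)
    then have "P n = (norm (A n))\<^sup>2 * (\<Sum>j<n. Re (cis (t n) ^ j * B n) * Re (cis (t' n) ^ j * B n))"
      unfolding P_def sum_distrib_left by (rule sum.cong[OF refl])
    then show ?thesis using A[of n] by simp
  qed
  show "(\<lambda>n. P n / (real n * (norm (A n))\<^sup>2)) \<longlonglongrightarrow> sinc \<phi> / 2"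
    using oscillation_product_limit[of B, OF B t \<theta> diff] unfolding eq .
  have lim0: "(\<lambda>n. sqrt (\<delta> n) * sqrt (\<delta>' n) + sqrt (\<delta> n) + sqrt (\<delta>' n)) \<longlonglongrightarrow> 0"
    using \<delta>(1,2) by (auto intro!: tendsto_eq_intros)
  show "(\<lambda>n. P n / (real n * (norm (A n))\<^sup>2) - (\<Sum>j<n. u n j * v n j) / (real n * (norm (A n))\<^sup>2)) \<longlonglongrightarrow> 0"
  proof (rule Lim_null_comparison[OF _ lim0])
    show "\<forall>\<^sub>F n in sequentially. norm (P n / (real n * (norm (A n))\<^sup>2) - (\<Sum>j<n. u n j * v n j) / (real n * (norm (A n))\<^sup>2))
        \<le> sqrt (\<delta> n) * sqrt (\<delta>' n) + sqrt (\<delta> n) + sqrt (\<delta>' n)"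
      using u v eventually_gt_at_top[of "0::nat"]
    proof eventually_elim
      case (elim n)
      define c where "c = real n * (norm (A n))\<^sup>2"
      have c: "c > 0" using elim A by (simp add: c_def)
      have sq: "(\<Sum>j<n. (Re (cis s ^ j * A n))\<^sup>2) \<le> c" for s
      proof -
        have "(Re (cis s ^ j * A n))\<^sup>2 \<le> (norm (A n))\<^sup>2" for j
          using abs_Re_le_cmod[of "cis s ^ j * A n"]
          by (intro abs_le_square_iff[THEN iffD1]) (simp add: norm_mult norm_power)
        then have "(\<Sum>j<n. (Re (cis s ^ j * A n))\<^sup>2) \<le> (\<Sum>j<n. (norm (A n))\<^sup>2)"
          by (intro sum_mono)
        then show ?thesis by (simp add: c_def)
      qed
      have "\<bar>(\<Sum>j<n. u n j * v n j) - P n\<bar>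
          \<le> (sqrt (\<delta> n) * sqrt (\<delta>' n) + sqrt (\<delta> n) + sqrt (\<delta>' n)) * c"
        unfolding P_def using elim(1,2) \<delta>(3,4) c
        by (intro sum_product_perturbation sq) (auto simp: c_def)
      then have "\<bar>P n - (\<Sum>j<n. u n j * v n j)\<bar> / c \<le> sqrt (\<delta> n) * sqrt (\<delta>' n) + sqrt (\<delta> n) + sqrt (\<delta>' n)"
        using c by (simp add: pos_divide_le_eq abs_minus_commute)
      then show ?case
        unfolding c_def[symmetric] diff_divide_distrib[symmetric] using c by simp
    qed
  qed
qed

lemma difference_quotient_sequence:
  fixes f :: "real \<Rightarrow> real"
  assumes "(f has_real_derivative D) (at x)"
  shows "(\<lambda>n. real n * (f (x + c / real n) - f x)) \<longlonglongrightarrow> c * D"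
proof (cases "c = 0")
  case False
  have "(\<lambda>h. (f (x + h) - f x) / h) \<midarrow>0\<rightarrow> D"
    using assms by (simp add: DERIV_def)
  moreover have "filterlim (\<lambda>n. c / real n) (at 0) sequentially"
    unfolding filterlim_at
  proof
    show "\<forall>\<^sub>F n in sequentially. c / real n \<in> UNIV \<and> c / real n \<noteq> 0"
      using eventually_gt_at_top[of "0::nat"] by eventually_elim (use False in auto)
    show "(\<lambda>n. c / real n) \<longlonglongrightarrow> 0" by (rule lim_const_over_n)
  qed
  ultimately have "(\<lambda>n. (f (x + c / real n) - f x) / (c / real n)) \<longlonglongrightarrow> D"
    by (rule filterlim_compose)
  then have "(\<lambda>n. c * ((f (x + c / real n) - f x) / (c / real n))) \<longlonglongrightarrow> c * D"
    by (rule tendsto_mult_left)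
  moreover have "\<forall>\<^sub>F n in sequentially. c * ((f (x + c / real n) - f x) / (c / real n))
      = real n * (f (x + c / real n) - f x)"
    using eventually_gt_at_top[of "0::nat"] by eventually_elim (use False in simp)
  ultimately show ?thesis by (rule Lim_transform_eventually)
qed simp

section \<open>Universality for sparse recursions\<close>

locale universal_szego_chain = szego_chain +
  assumes growth: "100 ^ k * d k \<le> d (Suc k)" and r_tendsto: "r \<longlonglongrightarrow> 0"
begin

section \<open>Size and variation of the amplitudes\<close>

definition amp :: "nat \<Rightarrow> complex \<Rightarrow> complex" where
  "amp k z = sqrt (2 / h k) *\<^sub>R (cnj z ^ d k * a k z)"

lemma orth_poly_amp:
  assumes "n > 0" and z: "norm z = 1"
  shows "poly (orth_poly n) (2 * Re z) = Re (z ^ n * amp (block n) z)"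
proof -
  define k where "k = block n"
  have nz: "z \<noteq> 0" using z by auto
  have "z powi (int n - int (d k)) * a k z = z ^ n * (cnj z ^ d k * a k z)"
    using nz cnj_unit_mult(3)[OF z] by (simp add: power_int_diff field_simps)
  then have "poly (monic n) (2 * Re z) = 2 * Re (z ^ n * (cnj z ^ d k * a k z))"
    using monic(3)[OF assms] unfolding k_def by presburger
  moreover have "poly (orth_poly n) (2 * Re z) = 1 / sqrt (2 * h k) * poly (monic n) (2 * Re z)"
    using assms(1) by (simp add: orth_poly_def k_def)
  ultimately have "poly (orth_poly n) (2 * Re z) = (2 / sqrt (2 * h k)) * Re (z ^ n * (cnj z ^ d k * a k z))"
    by (simp del: times_complex.sel)
  also have "2 / sqrt (2 * h k) = sqrt (2 / h k)"
    using h_pos[of k] by (simp add: real_sqrt_mult real_sqrt_divide field_simps)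
  finally show ?thesis
    unfolding amp_def k_def[symmetric] mult_scaleR_right scaleR_complex.sel .
qed

definition amp_factor :: "nat \<Rightarrow> real" where "amp_factor k = 1 / sqrt (1 - (r k)\<^sup>2)"

lemma amp_factor_bounds: "1 \<le> amp_factor k" "amp_factor k \<le> 1 + r k"
proof -
  have r2: "0 < 1 - (r k)\<^sup>2" using r2_less[of k] by simp
  then show "1 \<le> amp_factor k" by (simp add: amp_factor_def)
  have "r k * r k \<le> r k * (1/40)" using r_le[of k] r_pos[of k] by (intro mult_left_mono) auto
  then have "1 \<le> (1 + 3 * r k) * (1 - r k)" using r_pos[of k] by (simp add: algebra_simps)
  also have "\<dots> \<le> (1 + r k) ^ 3 * (1 - r k)"
    using r_pos[of k] r_le[of k] by (intro mult_right_mono) (auto simp: power3_eq_cube algebra_simps)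
  also have "\<dots> = (1 + r k)\<^sup>2 * (1 - (r k)\<^sup>2)"
    by (simp add: power3_eq_cube power2_eq_square algebra_simps)
  finally have "1 \<le> sqrt ((1 + r k)\<^sup>2 * (1 - (r k)\<^sup>2))" by simp
  then have "1 \<le> (1 + r k) * sqrt (1 - (r k)\<^sup>2)"
    using r_pos[of k] by (simp add: real_sqrt_mult)
  then show "amp_factor k \<le> 1 + r k" using r2 by (simp add: amp_factor_def field_simps)
qed

text \<open>Removing the rotation by \<open>cnj z ^ d k\<close> confines the new high frequency
  \<open>d (Suc k)\<close> to a term of relative size \<open>r k\<close>. One step is thus a small
  change in size, though possibly a large one in derivative.\<close>

lemma amp_Suc:
  assumes z: "norm z = 1"
  shows "amp (Suc k) z = amp_factor k *\<^sub>R (amp k z - r k *\<^sub>R (cnj z ^ d (Suc k) * cnj (amp k z)))"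
proof -
  have s: "sqrt (2 / h (Suc k)) = amp_factor k * sqrt (2 / h k)"
    by (simp add: h_Suc amp_factor_def real_sqrt_mult real_sqrt_divide)
  have 1: "cnj z ^ d (Suc k) * (z ^ m k * a k z) = (z ^ m k * cnj z ^ m k) * (cnj z ^ d k * a k z)"
    by (simp add: d_Suc power_add)
  have 2: "cnj z ^ d (Suc k) * b k z = cnj z ^ d (Suc k) * cnj (cnj z ^ d k * a k z)"
    unfolding pairD(8)[OF z] by simp
  have "cnj z ^ d (Suc k) * a (Suc k) z = cnj z ^ d (Suc k) * (z ^ m k * a k z)
      - r k *\<^sub>R (cnj z ^ d (Suc k) * b k z)"
    by (simp add: a_Suc right_diff_distrib scaleR_conv_of_real)
  also have "\<dots> = cnj z ^ d k * a k z - r k *\<^sub>R (cnj z ^ d (Suc k) * cnj (cnj z ^ d k * a k z))"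
    unfolding 1 2 cnj_unit_mult(3)[OF z] by simp
  finally show ?thesis
    unfolding amp_def s by (simp add: scaleR_right_diff_distrib mult.commute mult.left_commute)
qed

lemma amp_step:
  assumes z: "norm z = 1"
  shows "norm (amp (Suc k) z - amp k z) \<le> 3 * r k * norm (amp k z)"
proof -
  define N where "N = norm (amp k z)"
  define w where "w = cnj z ^ d (Suc k) * cnj (amp k z)"
  have w: "norm w = N" by (simp add: w_def N_def norm_mult norm_power z)
  have "amp (Suc k) z - amp k z = (amp_factor k - 1) *\<^sub>R amp k z - (amp_factor k * r k) *\<^sub>R w"
    unfolding amp_Suc[OF z] w_def[symmetric] by (simp add: algebra_simps)
  also have "norm \<dots> \<le> (amp_factor k - 1) * N + amp_factor k * r k * N"
    by (rule order.trans[OF norm_triangle_ineq4])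
       (use amp_factor_bounds[of k] r_pos[of k] in \<open>simp add: w abs_mult N_def\<close>)
  also have "\<dots> \<le> r k * N + 2 * r k * N"
    using amp_factor_bounds[of k] r_pos[of k] r_le[of k]
    by (intro add_mono mult_right_mono) (auto simp: N_def)
  finally show ?thesis by (simp add: N_def)
qed

lemma amp_step_bounds:
  assumes z: "norm z = 1"
  shows "norm (amp k z) / 2 \<le> norm (amp (Suc k) z)" "norm (amp (Suc k) z) \<le> 2 * norm (amp k z)"
proof -
  have "3 * r k * norm (amp k z) \<le> 3 / 40 * norm (amp k z)"
    using r_le[of k] by (intro mult_right_mono) auto
  then show "norm (amp k z) / 2 \<le> norm (amp (Suc k) z)" "norm (amp (Suc k) z) \<le> 2 * norm (amp k z)"
    using amp_step[OF z, of k] norm_triangle_ineq2[of "amp (Suc k) z" "amp k z"]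
      norm_triangle_ineq3[of "amp (Suc k) z" "amp k z"] norm_ge_zero[of "amp k z"] by linarith+
qed

lemma amp_bounds:
  assumes z: "norm z = 1"
  shows "sqrt 2 / 2 ^ k \<le> norm (amp k z)" "norm (amp k z) \<le> sqrt 2 * 2 ^ k"
proof (induction k)
  case 0
  show "sqrt 2 / 2 ^ 0 \<le> norm (amp 0 z)" "norm (amp 0 z) \<le> sqrt 2 * 2 ^ 0"
    using z by (simp_all add: amp_def h_def d_0 a_0 norm_mult)
next
  case (Suc k)
  show "sqrt 2 / 2 ^ Suc k \<le> norm (amp (Suc k) z)" "norm (amp (Suc k) z) \<le> sqrt 2 * 2 ^ Suc k"
  proof -
    have "sqrt 2 / 2 ^ Suc k = sqrt 2 / 2 ^ k / 2" "sqrt 2 * 2 ^ Suc k = 2 * (sqrt 2 * 2 ^ k)" by simp_all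
    note eq = this
    show "sqrt 2 / 2 ^ Suc k \<le> norm (amp (Suc k) z)"
      unfolding eq using divide_right_mono[OF Suc(1), of 2] amp_step_bounds(1)[OF z, of k]
      by (auto intro: order.trans)
    show "norm (amp (Suc k) z) \<le> sqrt 2 * 2 ^ Suc k"
      unfolding eq using mult_left_mono[OF Suc(2), of 2] amp_step_bounds(2)[OF z, of k]
      by (auto intro: order.trans)
  qed
qed

text \<open>The power \<open>cnj z ^ d (Suc k)\<close> costs a factor \<open>d (Suc k)\<close> and
  the previous amplitude at most \<open>sqrt 2 * 2 ^ k\<close>; base 4 absorbs the latter and the
  constants of each step. At distance of order \<open>1 / n\<close> the bound is useful when
  \<open>d k\<close> is small compared with \<open>n\<close>.\<close>

lemma amp_lipschitz:
  assumes z: "norm z = 1" and w: "norm w = 1"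
  shows "norm (amp k z - amp k w) \<le> 4 ^ k * real (d k) * norm (z - w)"
proof (induction k)
  case 0
  show ?case using cnj_unit_mult(2)[OF z] cnj_unit_mult(2)[OF w]
    by (simp add: amp_def d_0 a_0)
next
  case (Suc k)
  define D where "D = real (d (Suc k))"
  define e where "e = norm (z - w)"
  define f where "f z = cnj z ^ d (Suc k) * cnj (amp k z)" for z
  define L where "L = 4 ^ k * D * e"
  have dD: "real (d k) \<le> D" unfolding D_def by (simp add: d_Suc)
  have "norm (amp k z - amp k w) \<le> 4 ^ k * real (d k) * e" using Suc by (simp add: e_def)
  also have "\<dots> \<le> L"
    unfolding L_def using dD by (intro mult_right_mono mult_left_mono) (auto simp: e_def)
  finally have 1: "norm (amp k z - amp k w) \<le> L" .
  have "f z - f w = (cnj z ^ d (Suc k) - cnj w ^ d (Suc k)) * cnj (amp k z)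
      + cnj w ^ d (Suc k) * cnj (amp k z - amp k w)"
    by (simp add: f_def algebra_simps)
  also have "norm \<dots> \<le> norm (cnj z ^ d (Suc k) - cnj w ^ d (Suc k)) * norm (amp k z) + norm (amp k z - amp k w)"
    by (rule order.trans[OF norm_triangle_ineq])
       (simp only: norm_mult complex_mod_cnj norm_power w power_one mult_1 order_refl)
  finally have fz: "norm (f z - f w) \<le> norm (cnj z ^ d (Suc k) - cnj w ^ d (Suc k)) * norm (amp k z)
      + norm (amp k z - amp k w)" .
  have "norm (cnj z ^ d (Suc k) - cnj w ^ d (Suc k)) \<le> D * e"
    using norm_power_diff[of "cnj z" "cnj w" "d (Suc k)"] z w
    by (simp add: D_def e_def complex_cnj_diff[symmetric] del: complex_cnj_diff)
  then have "norm (cnj z ^ d (Suc k) - cnj w ^ d (Suc k)) * norm (amp k z) \<le> D * e * (sqrt 2 * 2 ^ k)"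
    using amp_bounds(2)[OF z] by (intro mult_mono) (auto simp: D_def e_def)
  also have "D * e * (sqrt 2 * 2 ^ k) \<le> D * e * (2 * 4 ^ k)"
  proof (intro mult_left_mono mult_mono power_mono)
    show "sqrt 2 \<le> 2" using real_sqrt_le_mono[of 2 4] by simp
  qed (auto simp: D_def e_def)
  also have "\<dots> = 2 * L" by (simp add: L_def)
  finally have 2: "norm (f z - f w) \<le> 3 * L"
    using 1 fz by linarith
  have "amp (Suc k) z - amp (Suc k) w = amp_factor k *\<^sub>R ((amp k z - amp k w) - r k *\<^sub>R (f z - f w))"
    unfolding amp_Suc[OF z] amp_Suc[OF w] f_def by (simp add: algebra_simps)
  then have eq: "norm (amp (Suc k) z - amp (Suc k) w) = amp_factor k * norm ((amp k z - amp k w) - r k *\<^sub>R (f z - f w))"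
    using amp_factor_bounds[of k] by simp
  have "norm ((amp k z - amp k w) - r k *\<^sub>R (f z - f w)) \<le> norm (amp k z - amp k w) + norm (r k *\<^sub>R (f z - f w))"
    by (rule norm_triangle_ineq4)
  moreover have "norm (r k *\<^sub>R (f z - f w)) \<le> 1/40 * norm (f z - f w)"
    using r_pos[of k] r_le[of k] mult_right_mono[of "r k" "1/40" "norm (f z - f w)"] by simp
  ultimately have "norm ((amp k z - amp k w) - r k *\<^sub>R (f z - f w)) \<le> 2 * L"
    using 1 2 norm_ge_zero[of "amp k z - amp k w"] by linarith
  then have "norm (amp (Suc k) z - amp (Suc k) w) \<le> 2 * (2 * L)"
    unfolding eq using amp_factor_bounds[of k] r_le[of k] by (intro mult_mono) auto
  then show ?case by (simp add: L_def D_def e_def mult_ac)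
qed

lemma amp_nonzero: "norm z = 1 \<Longrightarrow> amp k z \<noteq> 0"
  using amp_bounds(1)[of z k] by (smt (verit) norm_zero divide_pos_pos real_sqrt_gt_zero zero_less_power)

lemma norm_amp_mono_bound:
  assumes "norm z = 1" "i \<le> k"
  shows "norm (amp i z) \<le> sqrt 2 * 2 ^ k"
  using amp_bounds(2)[OF assms(1), of i] power_increasing[OF assms(2), of "2::real"]
  by (smt (verit) mult_left_mono real_sqrt_ge_zero)

lemma block_le_iff: "block j \<le> k \<longleftrightarrow> 2 * j < d (Suc k)"
proof
  assume "block j \<le> k"
  then have "d (Suc (block j)) \<le> d (Suc k)"
    by (intro monoD[OF strict_mono_mono[OF d_strict_mono]]) simp
  then show "2 * j < d (Suc k)" using block_upper[of j] by simp
next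
  assume "2 * j < d (Suc k)"
  then show "block j \<le> k" unfolding block_def by (rule Least_le)
qed

lemma block_mono: "i \<le> j \<Longrightarrow> block i \<le> block j"
  using block_upper[of j] unfolding block_le_iff by simp

text \<open>An error relative to \<open>real n * (norm (amp k z))\<^sup>2\<close> for points at
  distance \<open>D / n\<close>. First summand: at most \<open>d k\<close> early indices, each of
  size \<open>8 * 4 ^ k\<close>, against a squared amplitude of at least \<open>2 / 4 ^ k\<close>;
  with \<open>growth\<close> the ratio is 16/100 = 4/25. In the square: \<open>3 * r k\<close> for
  one recursion step, and the Lipschitz bound divided by the least amplitude, with ratio 8/100 =
  2/25. Any growth base above 16 would make these powers decay.\<close>

definition err :: "nat \<Rightarrow> real \<Rightarrow> real" where
  "err k D = 8 * (4/25) ^ k + (3 * r k + 4 * D * (2/25) ^ k)\<^sup>2"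

text \<open>
  On the blocks \<open>k\<close> and \<open>k + 1\<close> the polynomials have nearly constant amplitude \<open>amp k z\<close>;
  the earlier indices are too few to matter because of the rapid growth of \<open>d\<close>.
\<close>

lemma orth_poly_approximation:
  assumes k: "block n = Suc k" and z: "norm z = 1" and w: "norm w = 1"
  shows "(\<Sum>j<n. (poly (orth_poly j) (2 * Re w) - Re (w ^ j * amp k z))\<^sup>2)
    \<le> err k (real n * norm (w - z)) * (real n * (norm (amp k z))\<^sup>2)"
proof -
  define N where "N = norm (amp k z)"
  define D where "D = real n * norm (w - z)"
  define \<eta> where "\<eta> = 3 * r k + 4 * D * (2/25) ^ k"
  have n: "n > 0" using k block_le_iff[of 0 0] d_ge[of 1] by (cases n) auto
  have "\<not> block n \<le> k" using k by simp
  then have "d (Suc k) \<le> 2 * n" unfolding block_le_iff by simp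
  then have "100 ^ k * d k \<le> 2 * n" using growth[of k] by simp
  then have dn: "100 ^ k * real (d k) \<le> 2 * real n"
    using of_nat_mono[of "100 ^ k * d k" "2 * n", where 'a=real] by simp
  have N: "sqrt 2 / 2 ^ k \<le> N" "N > 0" using amp_bounds(1)[OF z] amp_nonzero[OF z] by (auto simp: N_def)
  have "2 / 4 ^ k = (sqrt 2 / 2 ^ k)\<^sup>2"
    by (simp add: power_divide power_mult[symmetric] mult.commute[of k] power_mult)
  also have "\<dots> \<le> N\<^sup>2" using N by (intro power_mono) auto
  finally have N2: "2 / 4 ^ k \<le> N\<^sup>2" .
  have early: "(poly (orth_poly j) (2 * Re w) - Re (w ^ j * amp k z))\<^sup>2 \<le> 8 * 4 ^ k"
    if "block j \<le> k" for j
  proof -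
    have "\<bar>poly (orth_poly j) (2 * Re w)\<bar> \<le> sqrt 2 * 2 ^ k"
    proof (cases "j = 0")
      case True
      have "1 * 1 \<le> sqrt 2 * 2 ^ k" by (intro mult_mono) auto
      then show ?thesis using True by (simp add: orth_poly_def)
    next
      case False
      have "\<bar>Re (w ^ j * amp (block j) w)\<bar> \<le> norm (w ^ j * amp (block j) w)" by (rule abs_Re_le_cmod)
      also have "\<dots> = norm (amp (block j) w)" by (simp add: norm_mult norm_power w)
      also have "\<dots> \<le> sqrt 2 * 2 ^ k" by (rule norm_amp_mono_bound[OF w that])
      finally show ?thesis using False by (subst orth_poly_amp[OF _ w]) auto
    qed
    moreover have "\<bar>Re (w ^ j * amp k z)\<bar> \<le> sqrt 2 * 2 ^ k"
      using abs_Re_le_cmod[of "w ^ j * amp k z"] amp_bounds(2)[OF z, of k]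
      by (simp add: norm_mult norm_power w del: times_complex.sel)
    ultimately have "\<bar>poly (orth_poly j) (2 * Re w) - Re (w ^ j * amp k z)\<bar> \<le> 2 * (sqrt 2 * 2 ^ k)"
      by linarith
    then have "\<bar>poly (orth_poly j) (2 * Re w) - Re (w ^ j * amp k z)\<bar>\<^sup>2 \<le> (2 * (sqrt 2 * 2 ^ k))\<^sup>2"
      by (intro power_mono) auto
    also have "\<dots> = 8 * 4 ^ k"
      by (simp add: power_mult_distrib power_mult[symmetric] mult.commute[of k] power_mult)
    finally show ?thesis by simp
  qed
  have base: "norm (amp k w - amp k z) \<le> 2 * D * (2/25) ^ k * N"
  proof -
    have "norm (amp k w - amp k z) * real n \<le> 4 ^ k * real (d k) * norm (w - z) * real n"
      by (intro mult_right_mono amp_lipschitz w z) auto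
    also have "\<dots> = (4/100) ^ k * D * (100 ^ k * real (d k))"
      unfolding D_def power_divide by simp
    also have "\<dots> \<le> (4/100) ^ k * D * (2 * real n)"
      using dn by (intro mult_left_mono) (auto simp: D_def)
    finally have "norm (amp k w - amp k z) \<le> (4/100) ^ k * D * 2"
      using n by simp
    also have "\<dots> \<le> (4/100) ^ k * D * 2 * (N * 2 ^ k)"
    proof -
      have "sqrt 2 \<le> N * 2 ^ k" using N by (simp add: field_simps)
      moreover have "1 \<le> sqrt 2" by simp
      ultimately have "1 \<le> N * 2 ^ k" by linarith
      then have "(4/100) ^ k * D * 2 * 1 \<le> (4/100) ^ k * D * 2 * (N * 2 ^ k)"
        by (intro mult_left_mono) (auto simp: D_def)
      then show ?thesis by simp
    qed
    also have "\<dots> = 2 * D * ((4/100) ^ k * 2 ^ k) * N" by simp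
    also have "(4/100) ^ k * 2 ^ k = (2/25 :: real) ^ k" by (simp add: power_mult_distrib[symmetric])
    finally show ?thesis .
  qed
  \<comment> \<open>The amplitude is frozen at \<open>k\<close> and not at \<open>Suc k\<close>:
    \<open>n\<close> may be comparable to \<open>d (Suc k)\<close>, and then the Lipschitz bound of
    the later amplitude is not small at distance \<open>D / n\<close>. So the last recursion step is
    undone at the same point \<open>w\<close>, at the price \<open>3 * r k\<close>, and only
    afterwards is \<open>w\<close> moved to \<open>z\<close>.\<close>
  have late: "(poly (orth_poly j) (2 * Re w) - Re (w ^ j * amp k z))\<^sup>2 \<le> \<eta>\<^sup>2 * N\<^sup>2"
    if j: "k \<le> block j" "block j \<le> Suc k" "j > 0" for j
  proof -
    have "norm (amp (block j) w - amp k w) \<le> 3 * r k * norm (amp k w)"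
    proof (cases "block j = k")
      case True then show ?thesis using r_pos[of k] by simp
    next
      case False
      then have "block j = Suc k" using j by simp
      then show ?thesis using amp_step[OF w] by simp
    qed
    also have "\<dots> \<le> 3 * r k * (N + norm (amp k w - amp k z))"
      using norm_triangle_sub[of "amp k w" "amp k z"] r_pos[of k] by (intro mult_left_mono) (auto simp: N_def)
    also have "\<dots> \<le> 3 * r k * N + 1 * norm (amp k w - amp k z)"
      unfolding distrib_left using r_le[of k] by (intro add_left_mono mult_right_mono) auto
    finally have "norm (amp (block j) w - amp k z) \<le> 3 * r k * N + 2 * norm (amp k w - amp k z)"
      using norm_triangle_ineq[of "amp (block j) w - amp k w" "amp k w - amp k z"] by simp
    also have "\<dots> \<le> \<eta> * N" using base by (simp add: \<eta>_def algebra_simps)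
    finally have 1: "norm (amp (block j) w - amp k z) \<le> \<eta> * N" .
    have "poly (orth_poly j) (2 * Re w) - Re (w ^ j * amp k z) = Re (w ^ j * (amp (block j) w - amp k z))"
      unfolding orth_poly_amp[OF j(3) w] by (simp only: right_diff_distrib minus_complex.sel)
    also have "\<bar>\<dots>\<bar> \<le> norm (w ^ j * (amp (block j) w - amp k z))" by (rule abs_Re_le_cmod)
    also have "\<dots> \<le> \<eta> * N" using 1 by (simp add: norm_mult norm_power w)
    finally have "\<bar>poly (orth_poly j) (2 * Re w) - Re (w ^ j * amp k z)\<bar>\<^sup>2 \<le> (\<eta> * N)\<^sup>2"
      by (intro power_mono) auto
    then show ?thesis by (simp add: power_mult_distrib)
  qed
  have "(\<Sum>j<n. (poly (orth_poly j) (2 * Re w) - Re (w ^ j * amp k z))\<^sup>2)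
      \<le> (\<Sum>j<n. (if 2 * j < d k then 8 * 4 ^ k else 0) + \<eta>\<^sup>2 * N\<^sup>2)"
  proof (rule sum_mono)
    fix j assume "j \<in> {..<n}"
    then have ub: "block j \<le> Suc k" using block_mono[of j n] k by simp
    show "(poly (orth_poly j) (2 * Re w) - Re (w ^ j * amp k z))\<^sup>2
        \<le> (if 2 * j < d k then 8 * 4 ^ k else 0) + \<eta>\<^sup>2 * N\<^sup>2"
    proof (cases "2 * j < d k")
      case True
      then have "2 * j < d (Suc k)" by (simp add: d_Suc)
      then have "block j \<le> k" unfolding block_le_iff .
      then show ?thesis using early[of j] True by (simp add: add_increasing2)
    next
      case False
      have "j > 0" using False d_odd[of k] by (cases j) (auto intro: ccontr)
      moreover have "k \<le> block j"
      proof (cases k)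
        case (Suc i)
        then have "\<not> block j \<le> i" using False unfolding block_le_iff by simp
        then show ?thesis using Suc by simp
      qed simp
      ultimately show ?thesis using late[of j] ub False by simp
    qed
  qed
  also have "\<dots> = (\<Sum>j<n. (if 2 * j < d k then 8 * 4 ^ k else 0)) + real n * (\<eta>\<^sup>2 * N\<^sup>2)"
    by (simp add: sum.distrib)
  also have "(\<Sum>j<n. (if 2 * j < d k then 8 * 4 ^ k else 0 :: real)) \<le> (\<Sum>j<d k. 8 * 4 ^ k)"
  proof -
    have "(\<Sum>j<n. (if 2 * j < d k then 8 * 4 ^ k else 0 :: real)) = (\<Sum>j\<in>{j. j < n \<and> 2 * j < d k}. 8 * 4 ^ k)"
      by (rule sum.mono_neutral_cong_right) auto
    also have "\<dots> \<le> (\<Sum>j<d k. 8 * 4 ^ k)" by (rule sum_mono2) auto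
    finally show ?thesis .
  qed
  also have "(\<Sum>j<d k. 8 * 4 ^ k) = 8 * (4/100) ^ k * (100 ^ k * real (d k))"
    unfolding power_divide by simp
  also have "\<dots> \<le> 8 * (4/100) ^ k * (2 * real n)"
    using dn by (intro mult_left_mono) auto
  also have "\<dots> = 8 * (4/25) ^ k * (real n * (2 / 4 ^ k))"
  proof -
    have "(4/100 :: real) ^ k = (4/25) ^ k / 4 ^ k" by (simp add: power_divide[symmetric])
    then show ?thesis by simp
  qed
  also have "\<dots> \<le> 8 * (4/25) ^ k * (real n * N\<^sup>2)"
    using N2 by (intro mult_left_mono) auto
  finally show ?thesis
    unfolding err_def D_def[symmetric] \<eta>_def[symmetric] N_def[symmetric] by (simp add: algebra_simps)
qed

lemma block_at_top: "filterlim block at_top sequentially"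
  unfolding filterlim_at_top
proof
  fix K :: nat
  show "\<forall>\<^sub>F n in sequentially. K \<le> block n"
    using eventually_ge_at_top[of "d (Suc K)"]
  proof eventually_elim
    case (elim n)
    then have "\<not> block n \<le> K" unfolding block_le_iff by simp
    then show ?case by simp
  qed
qed

lemma err_tendsto:
  assumes k: "filterlim k at_top sequentially" and D: "D \<longlonglongrightarrow> D0"
  shows "(\<lambda>n. err (k n) (D n)) \<longlonglongrightarrow> 0"
proof -
  have p: "(\<lambda>n. c ^ k n) \<longlonglongrightarrow> 0" if "0 \<le> c" "c < 1" for c :: real
    using filterlim_compose[OF LIMSEQ_realpow_zero[OF that] k] by simp
  have rk: "(\<lambda>n. r (k n)) \<longlonglongrightarrow> 0"
    using filterlim_compose[OF r_tendsto k] by simp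
  have "(\<lambda>n. err (k n) (D n)) \<longlonglongrightarrow> 8 * 0 + (3 * 0 + 4 * D0 * 0)\<^sup>2"
    unfolding err_def by (intro tendsto_intros p rk D) auto
  then show ?thesis by simp
qed

lemma err_nonneg: "err k D \<ge> 0"
  by (simp add: err_def)

text \<open>In the angle \<open>arccos (x / 2)\<close> a shift by \<open>c / n\<close> becomes
  \<open>- c / (n * sqrt (4 - x\<^sup>2))\<close> up to smaller order, which is where the scale of
  the sine kernel comes from. Numerator and denominator are both compared with the same
  \<open>c n\<close>, so the unknown amplitude drops out of the quotient.\<close>

theorem CD_universality:
  assumes x: "x \<in> {-2<..<2}"
  shows "(\<lambda>n. CD_kernel orth_poly n (x + \<alpha> / real n) (x + \<beta> / real n) / CD_kernel orth_poly n x x)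
     \<longlonglongrightarrow> sinc (inverse (sqrt (4 - x\<^sup>2)) * (\<beta> - \<alpha>))"
proof -
  define \<theta> where "\<theta> = arccos (x / 2)"
  define T where "T c n = arccos ((x + c / real n) / 2)" for c n
  define A where "A n = amp (block n - 1) (cis \<theta>)" for n
  define s where "s = sqrt (4 - x\<^sup>2)"
  have x2: "-1 < x / 2" "x / 2 < 1" using x by auto
  have \<theta>: "0 < \<theta>" "\<theta> < pi" unfolding \<theta>_def using arccos_lt_bounded[OF x2] by auto
  have "x\<^sup>2 < 4" using x abs_square_less_1[of "x / 2"] by (auto simp: power_divide)
  then have s: "s > 0" by (simp add: s_def)
  have "((\<lambda>y. arccos (y / 2)) has_real_derivative inverse (- sqrt (1 - (x / 2)\<^sup>2)) * (1 / 2)) (at x)"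
    using x2 by (intro DERIV_chain2[where f=arccos and g="\<lambda>y. y / 2"] DERIV_arccos)
      (auto intro!: derivative_eq_intros)
  moreover have "sqrt (1 - (x / 2)\<^sup>2) = s / 2"
  proof -
    have "1 - (x / 2)\<^sup>2 = (4 - x\<^sup>2) / 4" by (simp add: power_divide field_simps)
    then have "sqrt (1 - (x / 2)\<^sup>2) = sqrt ((4 - x\<^sup>2) / 4)" by (rule arg_cong)
    also have "\<dots> = s / 2" by (simp add: s_def real_sqrt_divide)
    finally show ?thesis .
  qed
  ultimately have deriv: "((\<lambda>y. arccos (y / 2)) has_real_derivative - inverse s) (at x)"
    by (simp add: field_simps)
  have diff: "(\<lambda>n. real n * (T c n - \<theta>)) \<longlonglongrightarrow> c * - inverse s" for c
    unfolding T_def \<theta>_def by (rule difference_quotient_sequence[OF deriv])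
  have Tlim: "T c \<longlonglongrightarrow> \<theta>" for c
  proof -
    have "(\<lambda>n. real n * (T c n - \<theta>) * (1 / real n)) \<longlonglongrightarrow> c * - inverse s * 0"
      by (intro tendsto_mult diff lim_1_over_n)
    moreover have "\<forall>\<^sub>F n in sequentially. real n * (T c n - \<theta>) * (1 / real n) = T c n - \<theta>"
      using eventually_gt_at_top[of "0::nat"] by eventually_elim simp
    ultimately have "(\<lambda>n. T c n - \<theta>) \<longlonglongrightarrow> 0"
      using Lim_transform_eventually by fastforce
    then show ?thesis by (simp add: LIM_zero_iff)
  qed
  have block1: "\<forall>\<^sub>F n in sequentially. block n = Suc (block n - 1)"
  proof -
    have "\<forall>\<^sub>F n in sequentially. 1 \<le> block n" using block_at_top unfolding filterlim_at_top by blast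
    then show ?thesis by eventually_elim simp
  qed
  have k_lim: "filterlim (\<lambda>n. block n - 1) at_top sequentially"
    unfolding filterlim_at_top
  proof
    fix K :: nat
    have "\<forall>\<^sub>F n in sequentially. Suc K \<le> block n" using block_at_top unfolding filterlim_at_top by blast
    then show "\<forall>\<^sub>F n in sequentially. K \<le> block n - 1" by eventually_elim simp
  qed
  define E where "E c n = err (block n - 1) (real n * norm (cis (T c n) - cis \<theta>))" for c n
  \<comment> \<open>The arc length replaces the chord because \<open>diff\<close> gives its limit
    directly; \<open>err\<close> is increasing in a nonnegative second argument.\<close>
  define E' where "E' c n = err (block n - 1) \<bar>real n * (T c n - \<theta>)\<bar>" for c n
  have E': "E' c \<longlonglongrightarrow> 0" for c
    unfolding E'_def by (rule err_tendsto[OF k_lim tendsto_rabs[OF diff]])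
  have EE': "E c n \<le> E' c n" for c n
  proof -
    have "real n * norm (cis (T c n) - cis \<theta>) \<le> real n * \<bar>T c n - \<theta>\<bar>"
      by (intro mult_left_mono norm_cis_diff_le) auto
    also have "\<dots> = \<bar>real n * (T c n - \<theta>)\<bar>" by (simp add: abs_mult)
    finally show ?thesis
      unfolding E_def E'_def err_def using r_pos[of "block n - 1"]
      by (intro add_left_mono power_mono mult_right_mono mult_left_mono) auto
  qed
  have close: "\<forall>\<^sub>F n in sequentially.
      (\<Sum>j<n. (poly (orth_poly j) (x + c / real n) - Re (cis (T c n) ^ j * A n))\<^sup>2) \<le> E' c n * (real n * (norm (A n))\<^sup>2)" for c
  proof -
    have lim: "(\<lambda>n. x + c / real n) \<longlonglongrightarrow> x + 0" by (intro tendsto_intros lim_const_over_n)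
    have "\<forall>\<^sub>F n in sequentially. x + c / real n > -2" "\<forall>\<^sub>F n in sequentially. x + c / real n < 2"
      using x by (auto intro!: order_tendstoD[OF lim])
    with block1 show ?thesis
    proof eventually_elim
      case (elim n)
      have "cos (T c n) = (x + c / real n) / 2"
        unfolding T_def using elim by (intro cos_arccos) auto
      then have *: "x + c / real n = 2 * Re (cis (T c n))" by simp
      have "(\<Sum>j<n. (poly (orth_poly j) (x + c / real n) - Re (cis (T c n) ^ j * A n))\<^sup>2)
          \<le> E c n * (real n * (norm (A n))\<^sup>2)"
        unfolding * A_def E_def by (rule orth_poly_approximation[OF elim(1)]) auto
      also have "\<dots> \<le> E' c n * (real n * (norm (A n))\<^sup>2)"
        by (intro mult_right_mono EE') auto
      finally show ?case .
    qed
  qed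
  have A0: "A n \<noteq> 0" for n unfolding A_def by (rule amp_nonzero) simp
  define c where "c n = real n * (norm (A n))\<^sup>2" for n
  have lim: "(\<lambda>n. CD_kernel orth_poly n (x + \<alpha> / real n) (x + \<beta> / real n) / c n)
      \<longlonglongrightarrow> sinc (inverse s * (\<beta> - \<alpha>)) / 2" for \<alpha> \<beta>
  proof -
    have "(\<lambda>n. real n * (T \<alpha> n - \<theta>) - real n * (T \<beta> n - \<theta>)) \<longlonglongrightarrow> \<alpha> * - inverse s - \<beta> * - inverse s"
      by (intro tendsto_diff diff)
    then have d: "(\<lambda>n. real n * (T \<alpha> n - T \<beta> n)) \<longlonglongrightarrow> inverse s * (\<beta> - \<alpha>)"
      by (simp add: algebra_simps)
    have nn: "E' c n \<ge> 0" for c n by (simp add: E'_def err_nonneg)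
    show ?thesis
      unfolding CD_kernel_def c_def
      by (rule perturbed_product_limit[OF A0 Tlim Tlim \<theta> d close close E' E' nn nn])
  qed
  have "(\<lambda>n. CD_kernel orth_poly n x x / c n) \<longlonglongrightarrow> 1 / 2"
    using lim[of 0 0] by simp
  then have "(\<lambda>n. CD_kernel orth_poly n (x + \<alpha> / real n) (x + \<beta> / real n) / c n / (CD_kernel orth_poly n x x / c n))
      \<longlonglongrightarrow> sinc (inverse s * (\<beta> - \<alpha>)) / 2 / (1 / 2)"
    by (rule tendsto_divide[OF lim]) simp
  moreover have "\<forall>\<^sub>F n in sequentially.
      CD_kernel orth_poly n (x + \<alpha> / real n) (x + \<beta> / real n) / c n / (CD_kernel orth_poly n x x / c n)
      = CD_kernel orth_poly n (x + \<alpha> / real n) (x + \<beta> / real n) / CD_kernel orth_poly n x x"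
    using eventually_gt_at_top[of "0::nat"] by eventually_elim (use A0 in \<open>simp add: c_def\<close>)
  ultimately have "(\<lambda>n. CD_kernel orth_poly n (x + \<alpha> / real n) (x + \<beta> / real n) / CD_kernel orth_poly n x x)
      \<longlonglongrightarrow> sinc (inverse s * (\<beta> - \<alpha>)) / 2 / (1 / 2)"
    by (rule Lim_transform_eventually)
  moreover have "y / 2 / (1 / 2) = y" for y :: real by simp
  ultimately show ?thesis unfolding s_def by metis
qed

end

section \<open>Choice of the gaps\<close>

text \<open>The squares are 1/1600 times the terms of the harmonic series, so their sum diverges
  although the coefficients tend to 0. The factor 40 keeps them in the range required by
  \<open>inverse_sqrt_bound\<close>.\<close>

definition verblunsky :: "nat \<Rightarrow> real" where "verblunsky k = 1 / (40 * sqrt (real (Suc k)))"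

lemma verblunsky_bounds: "0 < verblunsky k" "verblunsky k \<le> 1/40"
proof -
  have "1 \<le> sqrt (real (Suc k))" by simp
  then show "0 < verblunsky k" "verblunsky k \<le> 1/40" by (auto simp: verblunsky_def field_simps)
qed

lemma verblunsky_tendsto: "verblunsky \<longlonglongrightarrow> 0"
  unfolding verblunsky_def
  by (intro tendsto_divide_0[OF tendsto_const] filterlim_at_top_imp_at_infinity
        filterlim_tendsto_pos_mult_at_top[OF tendsto_const]
        filterlim_compose[OF sqrt_at_top] filterlim_compose[OF filterlim_real_sequentially filterlim_Suc]) simp

text \<open>By 1 - x <= exp (-x) the product is at most the exponential of minus a multiple of the
  harmonic numbers; 25600 is 16 times 1600.\<close>

lemma verblunsky_product_tendsto: "(\<lambda>k. \<Prod>i<k. 1 - (verblunsky i)\<^sup>2 / 16) \<longlonglongrightarrow> 0"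
proof -
  have bound: "(\<Prod>i<k. 1 - (verblunsky i)\<^sup>2 / 16) \<le> exp (- (harm k / 25600))" for k
  proof -
    have "(\<Prod>i<k. 1 - (verblunsky i)\<^sup>2 / 16) \<le> (\<Prod>i<k. exp (- (inverse (real (Suc i)) / 25600)))"
    proof (rule prod_mono)
      fix i assume "i \<in> {..<k}"
      have r2: "(verblunsky i)\<^sup>2 = inverse (real (Suc i)) / 1600"
        unfolding verblunsky_def by (simp add: power_divide power_mult_distrib field_simps)
      have "0 \<le> 1 - (verblunsky i)\<^sup>2 / 16" unfolding r2 by (simp add: field_simps)
      moreover have "1 - (verblunsky i)\<^sup>2 / 16 \<le> exp (- (inverse (real (Suc i)) / 25600))"
        using exp_ge_add_one_self[of "- (inverse (real (Suc i)) / 25600)"] unfolding r2 by simp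
      ultimately show "0 \<le> 1 - (verblunsky i)\<^sup>2 / 16 \<and> 1 - (verblunsky i)\<^sup>2 / 16 \<le> exp (- (inverse (real (Suc i)) / 25600))" ..
    qed
    also have "\<dots> = exp (\<Sum>i<k. - (inverse (real (Suc i)) / 25600))"
      by (rule exp_sum[symmetric]) simp
    also have "(\<Sum>i<k. - (inverse (real (Suc i)) / 25600)) = - (harm k / 25600)"
      unfolding sum_negf sum_divide_distrib[symmetric] harm_altdef by simp
    finally show ?thesis .
  qed
  have "filterlim (\<lambda>k. 1 / 25600 * harm k :: real) at_top sequentially"
    by (rule filterlim_tendsto_pos_mult_at_top[OF tendsto_const _ harm_at_top]) simp
  then have "filterlim (\<lambda>k. - (harm k / 25600) :: real) at_bot sequentially"
    by (simp add: filterlim_uminus_at_top)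
  then have lim: "(\<lambda>k. exp (- (harm k / 25600)) :: real) \<longlonglongrightarrow> 0"
    by (rule filterlim_compose[OF exp_at_bot])
  have "0 \<le> (\<Prod>i<k. 1 - (verblunsky i)\<^sup>2 / 16)" for k
  proof (rule prod_nonneg)
    fix i
    have "(verblunsky i)\<^sup>2 \<le> 1" using verblunsky_bounds[of i] by (intro power_le_one) auto
    then show "0 \<le> 1 - (verblunsky i)\<^sup>2 / 16" by simp
  qed
  then show ?thesis
    using bound by (intro Lim_null_comparison[OF _ lim]) simp
qed

section \<open>Recursive construction of the chain\<close>

type_synonym szego_state = "nat \<times> (complex \<Rightarrow> complex) \<times> (complex \<Rightarrow> complex)"

text \<open>All that is asked of a gap once the current pair is known: growth for universality, the
  two analytic conditions for singularity. Each holds for every sufficiently long gap, so they can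
  be met together; the approximating \<open>q\<close> depends only on the current pair, and the gap
  has merely to exceed its degree.\<close>

definition admissible_step :: "nat \<Rightarrow> szego_state \<Rightarrow> nat \<Rightarrow> bool" where
  "admissible_step k = (\<lambda>(d :: nat, a :: complex \<Rightarrow> complex, b :: complex \<Rightarrow> complex) m. m > 0 \<and> even m \<and> 100 ^ k * d \<le> d + m \<and>
     sqrt (1 - (verblunsky k)\<^sup>2) * integral {0..1} (\<lambda>t. 1 / norm (circ t ^ m * a (circ t) - verblunsky k * b (circ t)))
       \<le> (1 - (verblunsky k)\<^sup>2 / 16) * integral {0..1} (\<lambda>t. 1 / norm (a (circ t))) \<and>
     (\<exists>q. degree q < d + m \<and> (\<forall>z. norm z = 1 \<longrightarrow>
        \<bar>norm (a z) / sqrt (\<Prod>i<k. 1 - (verblunsky i)\<^sup>2) - poly q (2 * Re z)\<bar> \<le> 1 / real (Suc k))))"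

lemma ex_admissible_step:
  assumes ab: "szego_pair d a b"
  shows "\<exists>m. admissible_step k (d, a, b) m"
proof -
  note D = szego_pairD[OF ab]
  define H where "H = (\<Prod>i<k. 1 - (verblunsky i)\<^sup>2)"
  have "(verblunsky i)\<^sup>2 < 1" for i
    using verblunsky_bounds[of i] by (intro power2_less_1_iff[THEN iffD2]) auto
  then have H: "H > 0" unfolding H_def by (intro prod_pos) simp
  have cont: "continuous_on (sphere 0 1) (\<lambda>z. norm (a z) / sqrt H)"
    using H by (intro continuous_on_divide continuous_on_norm continuous_on_const D(11)) simp_all
  have sym: "norm (a (cnj z)) / sqrt H = norm (a z) / sqrt H" for z
    unfolding D(4)[symmetric] by simp
  obtain q where q: "\<And>z. norm z = 1 \<Longrightarrow> \<bar>norm (a z) / sqrt H - poly q (2 * Re z)\<bar> < 1 / real (Suc k)"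
    by (rule poly_approx_circle[OF cont sym, of "1 / real (Suc k)"]) (simp, blast)
  obtain m0 where m0: "\<And>m. m \<ge> m0 \<Longrightarrow> sqrt (1 - (verblunsky k)\<^sup>2) * integral {0..1} (\<lambda>t. 1 / norm (circ t ^ m * a (circ t) - verblunsky k * b (circ t)))
       \<le> (1 - (verblunsky k)\<^sup>2 / 16) * integral {0..1} (\<lambda>t. 1 / norm (a (circ t)))"
    using hellinger_step[OF ab verblunsky_bounds] unfolding eventually_sequentially by blast
  \<comment> \<open>The sum dominates each of the separate lower bounds; doubling makes the gap
    even.\<close>
  define m where "m = 2 * (Suc m0 + 100 ^ k * d + degree q)"
  have "admissible_step k (d, a, b) m"
    unfolding admissible_step_def prod.case
  proof (intro conjI exI[of _ q] allI impI)
    show "m > 0" "even m" "100 ^ k * d \<le> d + m" "degree q < d + m" by (auto simp: m_def)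
    show "sqrt (1 - (verblunsky k)\<^sup>2) * integral {0..1} (\<lambda>t. 1 / norm (circ t ^ m * a (circ t) - verblunsky k * b (circ t)))
       \<le> (1 - (verblunsky k)\<^sup>2 / 16) * integral {0..1} (\<lambda>t. 1 / norm (a (circ t)))"
      by (rule m0) (simp add: m_def)
    show "\<bar>norm (a z) / sqrt (\<Prod>i<k. 1 - (verblunsky i)\<^sup>2) - poly q (2 * Re z)\<bar> \<le> 1 / real (Suc k)"
      if "norm z = 1" for z
      using q[OF that] unfolding H_def by simp
  qed
  then show ?thesis ..
qed

fun next_state :: "nat \<Rightarrow> szego_state \<Rightarrow> nat \<Rightarrow> szego_state" where
  "next_state k (d, a, b) m =
     (d + m, (\<lambda>z. z ^ m * a z - of_real (verblunsky k) * b z), (\<lambda>z. b z - of_real (verblunsky k) * (z ^ m * a z)))"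

primrec state :: "nat \<Rightarrow> szego_state" where
  "state 0 = (1, (\<lambda>z. z), (\<lambda>_. 1))"
| "state (Suc k) = next_state k (state k) (SOME m. admissible_step k (state k) m)"

definition chain_degree :: "nat \<Rightarrow> nat" where "chain_degree k = fst (state k)"
definition chain_fun :: "nat \<Rightarrow> complex \<Rightarrow> complex" where "chain_fun k = fst (snd (state k))"
definition chain_rev :: "nat \<Rightarrow> complex \<Rightarrow> complex" where "chain_rev k = snd (snd (state k))"
definition chain_gap :: "nat \<Rightarrow> nat" where "chain_gap k = (SOME m. admissible_step k (state k) m)"

lemma state_eq: "state k = (chain_degree k, chain_fun k, chain_rev k)"
  by (simp add: chain_degree_def chain_fun_def chain_rev_def)

lemma state_Suc:
  "chain_degree (Suc k) = chain_degree k + chain_gap k"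
  "chain_fun (Suc k) = (\<lambda>z. z ^ chain_gap k * chain_fun k z - verblunsky k * chain_rev k z)"
  "chain_rev (Suc k) = (\<lambda>z. chain_rev k z - verblunsky k * (z ^ chain_gap k * chain_fun k z))"
proof -
  have "state (Suc k) = next_state k (chain_degree k, chain_fun k, chain_rev k) (chain_gap k)"
    by (simp add: chain_gap_def state_eq[symmetric])
  then show "chain_degree (Suc k) = chain_degree k + chain_gap k" "chain_fun (Suc k) = (\<lambda>z. z ^ chain_gap k * chain_fun k z - verblunsky k * chain_rev k z)"
    "chain_rev (Suc k) = (\<lambda>z. chain_rev k z - verblunsky k * (z ^ chain_gap k * chain_fun k z))"
    unfolding state_eq by simp_all
qed

lemma state_admissible: "szego_pair (chain_degree k) (chain_fun k) (chain_rev k) \<and> admissible_step k (chain_degree k, chain_fun k, chain_rev k) (chain_gap k)"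
proof (induction k)
  case 0
  have "szego_pair (chain_degree 0) (chain_fun 0) (chain_rev 0)"
    using szego_pair_init by (simp add: chain_degree_def chain_fun_def chain_rev_def)
  then show ?case
    using someI_ex[OF ex_admissible_step] unfolding chain_gap_def state_eq by blast
next
  case (Suc k)
  have "\<bar>verblunsky k\<bar> < 1" using verblunsky_bounds[of k] by simp
  moreover have "chain_gap k > 0" using Suc unfolding admissible_step_def by simp
  ultimately have "szego_pair (chain_degree (Suc k)) (chain_fun (Suc k)) (chain_rev (Suc k))"
    unfolding state_Suc using Suc by (intro szego_pair_step) auto
  then show ?case
    using someI_ex[OF ex_admissible_step] unfolding chain_gap_def state_eq by blast
qed

lemma singular_chain: "singular_szego_chain chain_degree chain_gap chain_fun chain_rev verblunsky"
proof
  fix k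
  show "chain_degree 0 = 1" "chain_fun 0 = (\<lambda>z. z)" "chain_rev 0 = (\<lambda>_. 1)" by (simp_all add: chain_degree_def chain_fun_def chain_rev_def)
  show "chain_degree (Suc k) = chain_degree k + chain_gap k" "chain_fun (Suc k) = (\<lambda>z. z ^ chain_gap k * chain_fun k z - verblunsky k * chain_rev k z)"
    "chain_rev (Suc k) = (\<lambda>z. chain_rev k z - verblunsky k * (z ^ chain_gap k * chain_fun k z))"
    by (rule state_Suc)+
  have adm: "admissible_step k (chain_degree k, chain_fun k, chain_rev k) (chain_gap k)" using state_admissible by blast
  show "chain_gap k > 0" "even (chain_gap k)" using adm unfolding admissible_step_def by simp_all
  show "verblunsky k > 0" "verblunsky k \<le> 1/40" by (rule verblunsky_bounds)+
  show "sqrt (1 - (verblunsky k)\<^sup>2) * integral {0..1} (\<lambda>t. 1 / norm (chain_fun (Suc k) (circ t)))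
      \<le> (1 - (verblunsky k)\<^sup>2 / 16) * integral {0..1} (\<lambda>t. 1 / norm (chain_fun k (circ t)))"
    using adm unfolding admissible_step_def state_Suc by simp
  show "\<exists>q. degree q < chain_degree (Suc k) \<and>
      (\<forall>z. norm z = 1 \<longrightarrow> \<bar>norm (chain_fun k z) / sqrt (\<Prod>i<k. 1 - (verblunsky i)\<^sup>2) - poly q (2 * Re z)\<bar> \<le> 1 / real (Suc k))"
    using adm unfolding admissible_step_def state_Suc by simp
qed (rule verblunsky_product_tendsto)

lemma universal_chain: "universal_szego_chain chain_degree chain_gap chain_fun chain_rev verblunsky"
proof -
  interpret singular_szego_chain chain_degree chain_gap chain_fun chain_rev verblunsky by (rule singular_chain)
  show ?thesis
  proof
    fix k
    show "100 ^ k * chain_degree k \<le> chain_degree (Suc k)"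
      using state_admissible[of k] unfolding admissible_step_def state_Suc by simp
  qed (rule verblunsky_tendsto)
qed

theorem corollary1p2:
  shows "\<exists>(M :: real measure) (p :: nat \<Rightarrow> real poly).
    real_distribution M \<and>
    compact (measure_support M) \<and> infinite (measure_support M) \<and>
    mutually_singular M lborel \<and>
    orthonormal_polys M p \<and>
    (\<forall>x \<in> {-2<..<2}. \<forall>a b :: real.
      (\<lambda>n. CD_kernel p n (x + a / real n) (x + b / real n) / CD_kernel p n x x)
        \<longlonglongrightarrow> sinc (inverse (sqrt (4 - x\<^sup>2)) * (b - a)))"
proof -
  interpret singular_szego_chain chain_degree chain_gap chain_fun chain_rev verblunsky by (rule singular_chain)
  interpret universal: universal_szego_chain chain_degree chain_gap chain_fun chain_rev verblunsky by (rule universal_chain)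
  obtain M where M: "chain_limit M" using ex_chain_limit ..
  show ?thesis
  proof (intro exI[of _ M] exI[of _ orth_poly] conjI ballI allI)
    show "real_distribution M" using M by (simp add: chain_limit_def)
    show "compact (measure_support M)" "infinite (measure_support M)"
      by (rule chain_limit_support[OF M])+
    show "mutually_singular M lborel" by (rule chain_limit_singular[OF M])
    show "orthonormal_polys M orth_poly" by (rule chain_limit_orthonormal[OF M])
  qed (rule universal.CD_universality)
qed

end
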